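(* Let $T$ be a fixed tree with $t\ge 2$ vertices. There is a constant $M$ (depending only on $T$) such that the following holds. If $\epsilon=\epsilon(n)>0$ and $p=p(n)\in(0,1]$ satisfy $\epsilon^4np\gg\log^2 n$, then, as $n\to\infty$ along multiples of $t$, with probability tending to $1$ the random graph $G_{n,p}$ contains a collection of pairwise edge-disjoint $T$-factors such that the number of edges of $G_{n,p}$ not covered by these $T$-factors is at most $M\epsilon\cdot|E(G_{n,p})|$.
   Context: $G_{n,p}$ is the random graph on $n$ labelled vertices in which each of the $\binom n2$ possible edges is present independently with probability $p$. For a graph $H$ with $t$ vertices and a graph $G$ with $n$ vertices, $t\mid n$, an $H$-factor of $G$ is a collection of $n/t$ vertex-disjoint (not necessarily induced) subgraphs of $G$, each isomorphic to $H$ (so they cover all vertices of $G$). $A_n\gg B_n$ means $A_n/B_n\to\infty$ as $n\to\infty$. Logarithms are natural. *)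

theory Defs
  imports "HOL-Probability.Probability" "HOL-Library.Ramsey"
begin

type_synonym 'a ugraph = "'a set \<times> 'a set set"

abbreviation verts :: "'a ugraph \<Rightarrow> 'a set" where
  "verts G \<equiv> fst G"

abbreviation edges :: "'a ugraph \<Rightarrow> 'a set set" where
  "edges G \<equiv> snd G"

(* nsets V 2 is the set of all two-element subsets of V *)
definition simple_graph :: "'a ugraph \<Rightarrow> bool" where
  "simple_graph G \<longleftrightarrow> finite (verts G) \<and> edges G \<subseteq> nsets (verts G) 2"

definition connected_graph :: "'a ugraph \<Rightarrow> bool" where
  "connected_graph G \<longleftrightarrow> verts G \<noteq> {} \<and>
     (\<forall>u\<in>verts G. \<forall>v\<in>verts G. (u, v) \<in> {(x, y). {x, y} \<in> edges G}\<^sup>*)"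

definition is_cycle :: "'a ugraph \<Rightarrow> 'a list \<Rightarrow> bool" where
  "is_cycle G xs \<longleftrightarrow> length xs \<ge> 3 \<and> distinct xs \<and>
     successively (\<lambda>x y. {x, y} \<in> edges G) xs \<and> {last xs, hd xs} \<in> edges G"

definition is_tree :: "'a ugraph \<Rightarrow> bool" where
  "is_tree G \<longleftrightarrow> simple_graph G \<and> connected_graph G \<and> \<not> (\<exists>xs. is_cycle G xs)"

definition subgraph :: "'a ugraph \<Rightarrow> 'a ugraph \<Rightarrow> bool" where
  "subgraph S G \<longleftrightarrow> simple_graph S \<and> verts S \<subseteq> verts G \<and> edges S \<subseteq> edges G"

definition graph_iso :: "'a ugraph \<Rightarrow> 'b ugraph \<Rightarrow> bool" where
  "graph_iso G H \<longleftrightarrow>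
     (\<exists>f. bij_betw f (verts G) (verts H) \<and> (\<lambda>e. f ` e) ` edges G = edges H)"

(* The cardinality condition says that there are n / t members
   (where n = card (verts G), t = card (verts H)) and entails t dvd n. *)
definition is_factor :: "'a ugraph \<Rightarrow> 'b ugraph \<Rightarrow> 'b ugraph set \<Rightarrow> bool" where
  "is_factor H G F \<longleftrightarrow>
     (\<forall>S\<in>F. subgraph S G \<and> graph_iso H S) \<and>
     pairwise (\<lambda>S S'. verts S \<inter> verts S' = {}) F \<and>
     card F * card (verts H) = card (verts G)"

definition factor_edges :: "'a ugraph set \<Rightarrow> 'a set set" where
  "factor_edges F = (\<Union>S\<in>F. edges S)"

definition edge_disjoint_factors ::
    "'a ugraph \<Rightarrow> 'b ugraph \<Rightarrow> 'b ugraph set set \<Rightarrow> bool" where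
  "edge_disjoint_factors H G C \<longleftrightarrow>
     (\<forall>F\<in>C. is_factor H G F) \<and>
     pairwise (\<lambda>F F'. factor_edges F \<inter> factor_edges F' = {}) C"

definition uncovered_edges :: "'b ugraph \<Rightarrow> 'b ugraph set set \<Rightarrow> 'b set set" where
  "uncovered_edges G C = edges G - (\<Union>F\<in>C. factor_edges F)"

definition random_graph :: "nat \<Rightarrow> real \<Rightarrow> nat ugraph pmf" where
  "random_graph n p =
     map_pmf (\<lambda>b. ({..<n}, {e \<in> nsets {..<n} 2. b e}))
       (Pi_pmf (nsets {..<n} 2) False (\<lambda>_. bernoulli_pmf p))"

definition multiples_at_top :: "nat \<Rightarrow> nat filter" where
  "multiples_at_top t = inf at_top (principal {n. t dvd n})"

end

theory Submission
  imports Defs "HOL-Real_Asymp.Real_Asymp"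
begin

text \<open>Take \<open>R\<close>, of order \<open>ln n / \<epsilon>\<^sup>2\<close>, partitions of the \<open>n = t m\<close> vertices into classes of size \<open>m\<close>
  indexed by the vertices of \<open>T\<close>, such that no pair of vertices lies across an edge of \<open>T\<close> in more than
  \<open>L\<close> of them, where \<open>L\<close> exceeds the average only by a factor \<open>(1 + \<epsilon>)\<^sup>2\<close>. Give every edge of
  \<open>G\<^bsub>n,p\<^esub>\<close> to a random one of the partitions in which it lies across an edge of \<open>T\<close>. Then each of the
  bipartite graphs belonging to a partition and an edge of \<open>T\<close> has independent edges of probability at
  least \<open>p / L\<close>. Since \<open>\<epsilon>\<^sup>2 m p / L\<close> is large compared with \<open>ln n\<close> (this is where
  \<open>\<epsilon>\<^sup>4 n p \<gg> ln\<^sup>2 n\<close> enters), a union bound shows that it satisfies the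
  cut condition for an \<open>r\<close>-regular spanning subgraph with \<open>r\<close> close to \<open>(1 - \<epsilon>) m p / L\<close>, and so has
  \<open>r\<close> disjoint perfect matchings. As \<open>T\<close> is a tree, the \<open>k\<close>-th matchings along its edges glue to
  a \<open>T\<close>-factor.\<close>

subsection \<open>Regular subgraphs of bipartite graphs\<close>

text \<open>The exponent four of \<open>\<epsilon>\<close> comes from two separate demands.
  Balancing the partitions for all of about \<open>n^2\<close> pairs at once is achieved with
  \<open>R\<close>, and therefore \<open>L\<close>, of order \<open>ln n / \<epsilon>^2\<close>. An
  edge is then shared among as many as \<open>L\<close> partitions, so one bipartite graph is only
  guaranteed density \<open>p / L\<close>, and its own union bound asks for
  \<open>\<epsilon>^2 m p / L\<close> of order \<open>ln n\<close> once more.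

  An upper bound on the multiplicities is all the balance required. If \<open>q\<close> is the
  proportion of pairs across tree edges in one partition, then \<open>L\<close> is
  \<open>q R\<close> up to the factor \<open>(1 + \<epsilon>)^2\<close>, so \<open>R\<close> cancels
  in the number \<open>R r (t - 1) m\<close> of covered edges, and this is nearly the expected
  number of all edges. Pairs of small multiplicity need no separate account.

  The gluing shapes the bipartite part: along all tree edges of a partition there must be the same
  number \<open>r\<close> of matchings, each of them perfect. Hence exactly regular spanning
  subgraphs are extracted, with one common degree, instead of working with almost regular
  graphs.\<close>

lemma card_Int_Times_eq_sum:
  assumes "finite A" "finite B"
  shows "card (E \<inter> A \<times> B) = (\<Sum>x\<in>A. card (E \<inter> {x} \<times> B))"
proof -
  have eq: "E \<inter> A \<times> B = (\<Union>x\<in>A. E \<inter> {x} \<times> B)" by auto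
  show ?thesis
    unfolding eq using assms by (intro card_UN_disjoint) auto
qed

lemma card_Int_Times_eq_sum':
  assumes "finite A" "finite B"
  shows "card (E \<inter> A \<times> B) = (\<Sum>y\<in>B. card (E \<inter> A \<times> {y}))"
proof -
  have eq: "E \<inter> A \<times> B = (\<Union>y\<in>B. E \<inter> A \<times> {y})" by auto
  show ?thesis
    unfolding eq using assms by (intro card_UN_disjoint) auto
qed

text \<open>Both rectangles on the left lie in the union of the two on the right and meet exactly in
  their intersection. This is submodularity for the order that shrinks one side while enlarging the
  other.\<close>

lemma card_Int_Times_uncross:
  assumes "finite E"
  shows "card (E \<inter> (A \<union> A') \<times> (B \<inter> B')) + card (E \<inter> (A \<inter> A') \<times> (B \<union> B'))
    \<le> card (E \<inter> A \<times> B) + card (E \<inter> A' \<times> B')" (is "card ?Q + card ?Q' \<le> card ?P + card ?P'")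
proof -
  have "card ?Q + card ?Q' = card (?Q \<union> ?Q') + card (?Q \<inter> ?Q')"
    using assms by (intro card_Un_Int) auto
  also have "\<dots> \<le> card (?P \<union> ?P') + card (?P \<inter> ?P')"
    using assms by (intro add_mono card_mono) auto
  also have "\<dots> = card ?P + card ?P'"
    using assms by (intro card_Un_Int[symmetric]) auto
  finally show ?thesis .
qed

definition biregular :: "nat \<Rightarrow> 'a set \<Rightarrow> 'b set \<Rightarrow> ('a \<times> 'b) set \<Rightarrow> bool" where
  "biregular r X Y E \<longleftrightarrow> E \<subseteq> X \<times> Y \<and> (\<forall>x\<in>X. card (E \<inter> {x} \<times> Y) = r) \<and>
     (\<forall>y\<in>Y. card (E \<inter> X \<times> {y}) = r)"

text \<open>The min-cut condition for a flow that sends \<open>r\<close> units into each vertex of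
  \<open>X\<close> and \<open>r\<close> units out of each vertex of \<open>Y\<close>, through edges
  of capacity one. For \<open>r = 1\<close> and sides of equal size it is equivalent to Hall's
  condition.\<close>

definition cut_condition :: "nat \<Rightarrow> 'a set \<Rightarrow> 'b set \<Rightarrow> ('a \<times> 'b) set \<Rightarrow> bool" where
  "cut_condition r X Y E \<longleftrightarrow>
     (\<forall>A B. A \<subseteq> X \<longrightarrow> B \<subseteq> Y \<longrightarrow> r * (card A + card B) \<le> card (E \<inter> A \<times> B) + r * card X)"

text \<open>Call \<open>(A, B)\<close> tight if it attains equality in the cut condition. In an edge-minimal graph
  every edge lies in a tight pair, and tight pairs can be uncrossed, so some tight \<open>(A, B)\<close> has
  \<open>x \<in> A\<close> and all neighbours of \<open>x\<close> in \<open>B\<close>. Comparing with \<open>(A - {x}, B)\<close> bounds the degree of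
  \<open>x\<close> by \<open>r\<close>.\<close>

lemma biregular_subgraph_exists:
  assumes fin: "finite X" "finite Y" and cXY: "card X = card Y"
    and EXY: "E \<subseteq> X \<times> Y" and cut: "cut_condition r X Y E"
  obtains F where "F \<subseteq> E" "biregular r X Y F"
proof -
  define m where "m = card X"
  have finE: "finite E" using fin EXY by (meson finite_SigmaI finite_subset)
  obtain F where F: "F \<subseteq> E" "cut_condition r X Y F"
    and Fmin: "\<And>F'. F' \<subseteq> E \<Longrightarrow> cut_condition r X Y F' \<Longrightarrow> card F \<le> card F'"
    using ex_has_least_nat[of "\<lambda>F. F \<subseteq> E \<and> cut_condition r X Y F" E card] cut by blast
  have FXY: "F \<subseteq> X \<times> Y" and finF: "finite F" using F EXY finE finite_subset by blast+
  have cutF: "r * (card A + card B) \<le> card (F \<inter> A \<times> B) + r * m" if "A \<subseteq> X" "B \<subseteq> Y" for A B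
    using F(2) that unfolding cut_condition_def m_def by blast
  define tight where "tight A B \<longleftrightarrow> A \<subseteq> X \<and> B \<subseteq> Y \<and> r * (card A + card B) = card (F \<inter> A \<times> B) + r * m" for A B
  have edge_tight: "\<exists>A B. tight A B \<and> x \<in> A \<and> y \<in> B" if xy: "(x, y) \<in> F" for x y
  proof -
    have "card (F - {(x, y)}) < card F" using xy finF by (intro card_Diff1_less)
    then have "\<not> cut_condition r X Y (F - {(x, y)})" using Fmin F(1) by (meson Diff_subset leD order_trans)
    then obtain A B where AB: "A \<subseteq> X" "B \<subseteq> Y"
      "card ((F - {(x, y)}) \<inter> A \<times> B) + r * m < r * (card A + card B)"
      unfolding cut_condition_def m_def by (auto simp: not_le)
    have in_AB: "x \<in> A \<and> y \<in> B"
    proof (rule ccontr)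
      assume "\<not> (x \<in> A \<and> y \<in> B)"
      then have "(F - {(x, y)}) \<inter> A \<times> B = F \<inter> A \<times> B" by auto
      then show False using AB cutF[of A B] by simp
    qed
    have "(F - {(x, y)}) \<inter> A \<times> B = F \<inter> A \<times> B - {(x, y)}" by auto
    then have "card ((F - {(x, y)}) \<inter> A \<times> B) = card (F \<inter> A \<times> B) - 1"
      using in_AB xy finF by simp
    then have "tight A B" using AB cutF[of A B] unfolding tight_def by linarith
    then show ?thesis using in_AB by blast
  qed
  \<comment> \<open>Both uncrossed pairs obey the cut condition, and by submodularity their slacks
    add up to at most those of the two tight pairs, which is zero; so both are tight.\<close>
  have uncross: "tight (A \<inter> A') (B \<union> B')" if "tight A B" "tight A' B'" for A B A' B'
  proof -
    have sub: "A \<subseteq> X" "A' \<subseteq> X" "B \<subseteq> Y" "B' \<subseteq> Y" using that by (auto simp: tight_def)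
    then have fins: "finite A" "finite A'" "finite B" "finite B'" using fin finite_subset by blast+
    have "card A + card A' = card (A \<union> A') + card (A \<inter> A')"
      "card B + card B' = card (B \<union> B') + card (B \<inter> B')"
      using fins by (auto intro: card_Un_Int)
    then have "r * (card A + card A') = r * (card (A \<union> A') + card (A \<inter> A'))"
      "r * (card B + card B') = r * (card (B \<union> B') + card (B \<inter> B'))" by metis+
    moreover have "r * (card (A \<union> A') + card (B \<inter> B')) \<le> card (F \<inter> (A \<union> A') \<times> (B \<inter> B')) + r * m"
      "r * (card (A \<inter> A') + card (B \<union> B')) \<le> card (F \<inter> (A \<inter> A') \<times> (B \<union> B')) + r * m"
      using sub by (auto intro!: cutF)
    moreover note card_Int_Times_uncross[OF finF, of A A' B B']
    ultimately show ?thesis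
      using that unfolding tight_def by (auto simp: algebra_simps)
  qed
  have deg: "card (F \<inter> {x} \<times> Y) = r" if x: "x \<in> X" for x
  proof -
    have "\<exists>A B. tight A B \<and> x \<in> A \<and> S \<subseteq> B" if "finite S" "S \<subseteq> F `` {x}" for S
      using that
    proof (induction S)
      case empty
      \<comment> \<open>This pair has no slack whatever \<open>F\<close> is, so the induction over
        the neighbours of \<open>x\<close> can start from it.\<close>
      have "tight X {}" by (simp add: tight_def m_def)
      then show ?case using x by blast
    next
      case (insert y S)
      then obtain A B where "tight A B" "x \<in> A" "S \<subseteq> B" by blast
      moreover obtain A' B' where "tight A' B'" "x \<in> A'" "y \<in> B'"
        using insert.prems edge_tight[of x y] by auto
      ultimately have "tight (A \<inter> A') (B \<union> B')" "x \<in> A \<inter> A'" "insert y S \<subseteq> B \<union> B'"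
        using uncross by auto
      then show ?case by blast
    qed
    from this[of "F `` {x}"] obtain A B where AB: "tight A B" "x \<in> A" "F `` {x} \<subseteq> B"
      using finF by auto
    have sub: "A \<subseteq> X" "B \<subseteq> Y" using AB(1) by (auto simp: tight_def)
    then have finA: "finite A" using fin(1) finite_subset by blast
    have "F \<inter> A \<times> B = F \<inter> (A - {x}) \<times> B \<union> F \<inter> {x} \<times> Y" using AB sub FXY by auto
    then have "card (F \<inter> A \<times> B) = card (F \<inter> (A - {x}) \<times> B) + card (F \<inter> {x} \<times> Y)"
      using finF by (simp, intro card_Un_disjoint) auto
    moreover have "r * (card (A - {x}) + card B) \<le> card (F \<inter> (A - {x}) \<times> B) + r * m"
      using sub by (intro cutF) auto
    moreover have "card A = Suc (card (A - {x}))" using AB(2) finA by (metis card_Suc_Diff1)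
    ultimately have "card (F \<inter> {x} \<times> Y) \<le> r" using AB(1) by (simp add: tight_def algebra_simps)
    \<comment> \<open>The pair \<open>({x}, Y)\<close> gives the reverse inequality, because
      \<open>card Y = m\<close>.\<close>
    moreover have "r * (card {x} + card Y) \<le> card (F \<inter> {x} \<times> Y) + r * m"
      using x by (intro cutF) auto
    ultimately show ?thesis using cXY by (simp add: m_def)
  qed
  have degY_ge: "r \<le> card (F \<inter> X \<times> {y})" if "y \<in> Y" for y
  proof -
    have "r * (card X + card {y}) \<le> card (F \<inter> X \<times> {y}) + r * m"
      using that by (intro cutF) auto
    then show ?thesis by (simp add: m_def)
  qed
  \<comment> \<open>On the side of \<open>Y\<close> each degree is at least \<open>r\<close>, while
    counting from \<open>X\<close> shows that they average exactly \<open>r\<close>.\<close>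
  have "card (F \<inter> X \<times> Y) = r * m"
    using deg fin by (subst card_Int_Times_eq_sum) (simp_all add: m_def)
  then have total: "(\<Sum>y\<in>Y. card (F \<inter> X \<times> {y})) = (\<Sum>y\<in>Y. r)"
    using fin cXY by (subst (asm) card_Int_Times_eq_sum') (simp_all add: m_def)
  have "card (F \<inter> X \<times> {y}) = r" if "y \<in> Y" for y
    using sum_mono_inv[OF total[symmetric] degY_ge that fin(2)] by simp
  then have "biregular r X Y F" unfolding biregular_def using deg FXY by blast
  then show thesis using that F(1) by blast
qed

section \<open>Decomposition of regular bipartite graphs into perfect matchings\<close>

text \<open>Of the \<open>Suc r * card A\<close> edges at \<open>A\<close>, at most
  \<open>Suc r * card (Y - B)\<close> can end outside \<open>B\<close>. The excess that must run
  into \<open>B\<close> is thus a positive multiple of \<open>card A - card (Y - B)\<close> when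
  that is positive.\<close>

lemma biregular_imp_cut_condition_1:
  assumes fin: "finite X" "finite Y" and cXY: "card X = card Y"
    and reg: "biregular (Suc r) X Y E"
  shows "cut_condition 1 X Y E"
  unfolding cut_condition_def
proof (intro allI impI)
  fix A B assume AB: "A \<subseteq> X" "B \<subseteq> Y"
  have finE: "finite E" using reg fin unfolding biregular_def by (meson finite_SigmaI finite_subset)
  have finAB: "finite A" "finite B" using AB fin finite_subset by blast+
  have "Suc r * card A = card (E \<inter> A \<times> Y)"
    using reg AB fin(2) finAB(1) by (subst card_Int_Times_eq_sum) (auto simp: biregular_def subset_eq)
  also have "E \<inter> A \<times> Y = E \<inter> A \<times> B \<union> E \<inter> A \<times> (Y - B)" using AB by auto
  also have "card \<dots> \<le> card (E \<inter> A \<times> B) + card (E \<inter> A \<times> (Y - B))" by (rule card_Un_le)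
  also have "card (E \<inter> A \<times> (Y - B)) \<le> card (E \<inter> X \<times> (Y - B))"
    using finE AB by (intro card_mono) auto
  also have "\<dots> = Suc r * (card Y - card B)"
    using reg fin AB finAB by (subst card_Int_Times_eq_sum') (auto simp: biregular_def card_Diff_subset)
  finally have le: "Suc r * card A \<le> card (E \<inter> A \<times> B) + Suc r * (card Y - card B)" by simp
  have cB: "card B \<le> card Y" using AB fin by (intro card_mono)
  show "1 * (card A + card B) \<le> card (E \<inter> A \<times> B) + 1 * card X"
  proof (cases "card A \<le> card Y - card B")
    case True
    then show ?thesis using cB cXY by simp
  next
    case False
    then obtain d where "card A = card Y - card B + d" by (metis le_add_diff_inverse nat_le_linear)
    then have "card A = card Y - card B + d" "d \<le> Suc r * d" by auto
    with le have "d \<le> card (E \<inter> A \<times> B)" by (simp add: algebra_simps)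
    then show ?thesis using \<open>card A = _\<close> cB cXY by simp
  qed
qed

lemma biregular_1_imp_matching:
  assumes fin: "finite X" "finite Y" and cXY: "card X = card Y"
    and reg: "biregular 1 X Y M"
  obtains g where "bij_betw g X Y" "M = (\<lambda>x. (x, g x)) ` X"
proof -
  have "\<exists>y. M \<inter> {x} \<times> Y = {(x, y)}" if x: "x \<in> X" for x
  proof -
    obtain z where z: "M \<inter> {x} \<times> Y = {z}"
      using reg x unfolding biregular_def by (metis card_1_singletonE)
    then have "z \<in> {x} \<times> Y" by auto
    then show ?thesis using z by auto
  qed
  then obtain g where g: "\<And>x. x \<in> X \<Longrightarrow> M \<inter> {x} \<times> Y = {(x, g x)}" by metis
  have gM: "(x, g x) \<in> M \<and> g x \<in> Y" if "x \<in> X" for x using g[OF that] by auto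
  have inj: "inj_on g X"
  proof (rule inj_onI)
    fix x x' assume x: "x \<in> X" "x' \<in> X" "g x = g x'"
    obtain z where "M \<inter> X \<times> {g x} = {z}"
      using reg gM x unfolding biregular_def by (metis card_1_singletonE)
    moreover have "(x, g x) \<in> M \<inter> X \<times> {g x}" "(x', g x) \<in> M \<inter> X \<times> {g x}"
      using gM[OF x(1)] gM[OF x(2)] x by auto
    ultimately show "x = x'" by auto
  qed
  have "g ` X = Y"
    using gM fin cXY inj by (intro card_subset_eq) (auto simp: card_image)
  moreover have "M = (\<lambda>x. (x, g x)) ` X"
  proof
    show "(\<lambda>x. (x, g x)) ` X \<subseteq> M" using gM by auto
    show "M \<subseteq> (\<lambda>x. (x, g x)) ` X"
    proof
      fix z assume z: "z \<in> M"
      then have "fst z \<in> X" "z \<in> M \<inter> {fst z} \<times> Y" using reg unfolding biregular_def by force+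
      then have "z = (fst z, g (fst z))" using g[of "fst z"] by auto
      then show "z \<in> (\<lambda>x. (x, g x)) ` X" using \<open>fst z \<in> X\<close> by (metis image_eqI)
    qed
  qed
  ultimately show thesis using that inj by (auto simp: bij_betw_def)
qed

text \<open>A regular graph of positive degree meets the cut condition for \<open>1\<close>, so the
  theorem on regular subgraphs, used with degree one, supplies a perfect matching; deleting it
  lowers every degree by one. Injectivity of \<open>k \<mapsto> g k x\<close> encodes that the
  matchings are edge-disjoint.\<close>

lemma biregular_decomposition:
  assumes fin: "finite X" "finite Y" and cXY: "card X = card Y"
    and reg: "biregular r X Y E"
  shows "\<exists>g. (\<forall>k<r. bij_betw (g k) X Y \<and> (\<forall>x\<in>X. (x, g k x) \<in> E)) \<and>
           (\<forall>x\<in>X. inj_on (\<lambda>k. g k x) {..<r})"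
  using reg
proof (induction r arbitrary: E)
  case 0
  then show ?case by simp
next
  case (Suc r)
  have EXY: "E \<subseteq> X \<times> Y" using Suc.prems by (simp add: biregular_def)
  have finE: "finite E" using EXY fin by (meson finite_SigmaI finite_subset)
  obtain M where M: "M \<subseteq> E" "biregular 1 X Y M"
    using biregular_subgraph_exists[OF fin cXY EXY biregular_imp_cut_condition_1[OF fin cXY Suc.prems]] .
  obtain h where h: "bij_betw h X Y" "M = (\<lambda>x. (x, h x)) ` X"
    using biregular_1_imp_matching[OF fin cXY M(2)] .
  have diff: "card ((E - M) \<inter> S) = card (E \<inter> S) - card (M \<inter> S)" for S
  proof -
    have "(E - M) \<inter> S = E \<inter> S - M \<inter> S" by auto
    moreover have "finite (M \<inter> S)" using M(1) finE finite_subset by blast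
    moreover have "M \<inter> S \<subseteq> E \<inter> S" using M(1) by auto
    ultimately show ?thesis by (simp only: card_Diff_subset)
  qed
  have "biregular r X Y (E - M)"
    using Suc.prems M EXY unfolding biregular_def by (auto simp: diff)
  then obtain g where g: "\<forall>k<r. bij_betw (g k) X Y \<and> (\<forall>x\<in>X. (x, g k x) \<in> E - M)"
    "\<forall>x\<in>X. inj_on (\<lambda>k. g k x) {..<r}"
    using Suc.IH by blast
  have ne: "g k x \<noteq> h x" if "k < r" "x \<in> X" for k x
    using g(1) h(2) that by force
  have "(\<forall>k<Suc r. bij_betw ((g(r := h)) k) X Y \<and> (\<forall>x\<in>X. (x, (g(r := h)) k x) \<in> E))"
    using g(1) h M by (auto simp: less_Suc_eq)
  moreover have "\<forall>x\<in>X. inj_on (\<lambda>k. (g(r := h)) k x) {..<Suc r}"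
  proof
    fix x assume x: "x \<in> X"
    have "inj_on (\<lambda>k. (g(r := h)) k x) {..<r}"
      using g(2) x by (auto simp: inj_on_def)
    then show "inj_on (\<lambda>k. (g(r := h)) k x) {..<Suc r}"
      using ne x by (force simp: lessThan_Suc inj_on_insert)
  qed
  ultimately show ?case by blast
qed

lemma edge_disjoint_perfect_matchings:
  assumes "finite X" "finite Y" "card X = card Y" "E \<subseteq> X \<times> Y" "cut_condition r X Y E"
  obtains g where "\<And>k. k < r \<Longrightarrow> bij_betw (g k) X Y"
    "\<And>k x. k < r \<Longrightarrow> x \<in> X \<Longrightarrow> (x, g k x) \<in> E"
    "\<And>x. x \<in> X \<Longrightarrow> inj_on (\<lambda>k. g k x) {..<r}"
proof -
  obtain F where "F \<subseteq> E" "biregular r X Y F"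
    using biregular_subgraph_exists[OF assms] .
  then show thesis
    using biregular_decomposition[OF assms(1-3), of r F] that by (metis subsetD)
qed

subsection \<open>Trees\<close>

text \<open>Paths are lists of distinct vertices inside \<open>S\<close>, the format of
  \<open>is_cycle\<close>, so that one outside vertex adjacent to both ends turns such a path into a
  cycle.\<close>

definition path_connected_in :: "'a ugraph \<Rightarrow> 'a set \<Rightarrow> bool" where
  "path_connected_in G S \<longleftrightarrow> (\<forall>x\<in>S. \<forall>y\<in>S. \<exists>xs. xs \<noteq> [] \<and> distinct xs \<and> set xs \<subseteq> S \<and>
     hd xs = x \<and> last xs = y \<and> successively (\<lambda>a b. {a, b} \<in> edges G) xs)"

lemma path_connected_in_insert:
  assumes S: "path_connected_in G S" and u: "u \<in> S" "{u, w} \<in> edges G" and w: "w \<notin> S"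
  shows "path_connected_in G (insert w S)"
  unfolding path_connected_in_def
proof (intro ballI)
  let ?adj = "\<lambda>a b. {a, b} \<in> edges G"
  fix x y assume xy: "x \<in> insert w S" "y \<in> insert w S"
  have old: "\<exists>xs. xs \<noteq> [] \<and> distinct xs \<and> set xs \<subseteq> S \<and> hd xs = x \<and> last xs = y \<and> successively ?adj xs"
    if "x \<in> S" "y \<in> S" for x y using S that unfolding path_connected_in_def by blast
  consider "x = w" "y = w" | "x \<in> S" "y \<in> S" | "x = w" "y \<in> S" | "x \<in> S" "y = w"
    using xy by blast
  then show "\<exists>xs. xs \<noteq> [] \<and> distinct xs \<and> set xs \<subseteq> insert w S \<and> hd xs = x \<and> last xs = y \<and> successively ?adj xs"
  proof cases
    case 1
    then show ?thesis by (intro exI[of _ "[w]"]) auto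
  next
    case 2
    then show ?thesis using old[of x y] by blast
  next
    case 3
    obtain xs where xs: "xs \<noteq> []" "distinct xs" "set xs \<subseteq> S" "hd xs = u" "last xs = y" "successively ?adj xs"
      using old[OF u(1) 3(2)] by blast
    then show ?thesis
      using 3 u w by (intro exI[of _ "w # xs"]) (auto simp: successively_Cons insert_commute)
  next
    case 4
    obtain xs where xs: "xs \<noteq> []" "distinct xs" "set xs \<subseteq> S" "hd xs = x" "last xs = u" "successively ?adj xs"
      using old[OF 4(1) u(1)] by blast
    then show ?thesis
      using 4 u w by (intro exI[of _ "xs @ [w]"]) (auto simp: successively_append_iff)
  qed
qed

text \<open>A path inside \<open>S\<close> from \<open>u\<close> to a different \<open>u'\<close>
  would close up through \<open>w\<close>; it has at least two vertices, so the cycle reaches the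
  required length three.\<close>

lemma acyclic_unique_neighbour:
  assumes S: "path_connected_in G S" and acyc: "\<not> (\<exists>xs. is_cycle G xs)"
    and u: "u \<in> S" "{u, w} \<in> edges G" and u': "u' \<in> S" "{u', w} \<in> edges G" and w: "w \<notin> S"
  shows "u = u'"
proof (rule ccontr)
  assume ne: "u \<noteq> u'"
  obtain xs where xs: "xs \<noteq> []" "distinct xs" "set xs \<subseteq> S" "hd xs = u" "last xs = u'"
      "successively (\<lambda>a b. {a, b} \<in> edges G) xs"
    using S u(1) u'(1) unfolding path_connected_in_def by blast
  have "length xs \<ge> 2" using xs ne by (cases xs; cases "tl xs") auto
  then have "is_cycle G (w # xs)"
    unfolding is_cycle_def using xs u u' w by (auto simp: successively_Cons insert_commute)
  then show False using acyc by blast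
qed

lemma connected_graph_boundary_edge:
  assumes G: "simple_graph G" "connected_graph G" and S: "S \<subseteq> verts G" "S \<noteq> {}" "S \<noteq> verts G"
  obtains u w where "u \<in> S" "w \<in> verts G - S" "{u, w} \<in> edges G"
proof -
  obtain a b where a: "a \<in> S" and b: "b \<in> verts G" "b \<notin> S" using S by blast
  let ?R = "{(x, y). {x, y} \<in> edges G}"
  have ab: "(a, b) \<in> ?R\<^sup>*" using G(2) a b S unfolding connected_graph_def by blast
  have "\<exists>u\<in>S. \<exists>w. w \<notin> S \<and> (u, w) \<in> ?R"
  proof (rule ccontr)
    assume no: "\<not> ?thesis"
    have "c \<in> S" if "(a, c) \<in> ?R\<^sup>*" for c
      using that by (induction rule: rtrancl_induct) (use a no in blast)+
    then show False using ab b by blast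
  qed
  then obtain u w where uw: "u \<in> S" "w \<notin> S" "{u, w} \<in> edges G" by blast
  then have "w \<in> verts G" using G(1) unfolding simple_graph_def nsets_def by blast
  then show thesis using that uw by blast
qed

text \<open>The tree is grown one vertex at a time: connectedness provides an edge leaving the
  current set, acyclicity makes it the only edge from the new vertex back. Later constructions along
  the tree become recursions on this order, with \<open>v 0\<close> as root.\<close>

lemma tree_parent_enumeration:
  assumes tree: "is_tree T"
  shows "\<exists>v par. bij_betw v {..<card (verts T)} (verts T) \<and>
    (\<forall>i\<in>{1..<card (verts T)}. par i < i) \<and>
    edges T = (\<lambda>i. {v i, v (par i)}) ` {1..<card (verts T)}"
proof -
  define t where "t = card (verts T)"
  have simple: "simple_graph T" and conn: "connected_graph T" and acyc: "\<not> (\<exists>xs. is_cycle T xs)"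
    using tree by (auto simp: is_tree_def)
  have fin: "finite (verts T)" and edge2: "\<And>e. e \<in> edges T \<Longrightarrow> e \<subseteq> verts T \<and> card e = 2"
    using simple by (auto simp: simple_graph_def nsets_def)
  have ex: "\<exists>v par. inj_on v {..<j} \<and> v ` {..<j} \<subseteq> verts T \<and> (\<forall>i\<in>{1..<j}. par i < i) \<and>
      {e \<in> edges T. e \<subseteq> v ` {..<j}} = (\<lambda>i. {v i, v (par i)}) ` {1..<j} \<and>
      path_connected_in T (v ` {..<j})" if "1 \<le> j" "j \<le> t" for j
    using that
  proof (induction j rule: nat_induct_at_least)
    case base
    obtain a where a: "a \<in> verts T" using conn by (auto simp: connected_graph_def)
    have "e \<notin> edges T" if "e \<subseteq> {a}" for e
      using edge2[of e] that by (auto simp: subset_singleton_iff)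
    moreover have "path_connected_in T {a}"
      unfolding path_connected_in_def by (auto intro!: exI[of _ "[a]"])
    ultimately show ?case
      using a by (intro exI[of _ "\<lambda>_. a"] exI[of _ "\<lambda>_. 0"]) (auto simp: lessThan_Suc)
  next
    case (Suc j)
    then obtain v par where IH: "inj_on v {..<j}" "v ` {..<j} \<subseteq> verts T" "\<forall>i\<in>{1..<j}. par i < i"
      "{e \<in> edges T. e \<subseteq> v ` {..<j}} = (\<lambda>i. {v i, v (par i)}) ` {1..<j}"
      "path_connected_in T (v ` {..<j})" by auto
    define S where "S = v ` {..<j}"
    have "card S = j" using IH(1) by (simp add: S_def card_image)
    then have "S \<noteq> verts T" using Suc.prems by (auto simp: t_def)
    moreover have "S \<noteq> {}" "S \<subseteq> verts T" using Suc.hyps IH(2) by (auto simp: S_def lessThan_empty_iff)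
    ultimately obtain u w where uw: "u \<in> S" "w \<in> verts T - S" "{u, w} \<in> edges T"
      using connected_graph_boundary_edge[OF simple conn] by metis
    obtain i0 where i0: "i0 < j" "v i0 = u" using uw(1) by (auto simp: S_def)
    define v' where "v' = v(j := w)"
    define par' where "par' = par(j := i0)"
    have v'S: "v' ` {..<Suc j} = insert w S" by (auto simp: v'_def S_def lessThan_Suc)
    \<comment> \<open>The only new induced edge is \<open>{w, u}\<close>, since a second neighbour
      of \<open>w\<close> in \<open>S\<close> would create a cycle.\<close>
    have "{e \<in> edges T. e \<subseteq> insert w S} = insert {w, u} {e \<in> edges T. e \<subseteq> S}"
    proof (intro equalityI subsetI)
      fix e assume e: "e \<in> {e \<in> edges T. e \<subseteq> insert w S}"
      show "e \<in> insert {w, u} {e \<in> edges T. e \<subseteq> S}"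
      proof (cases "w \<in> e")
        case True
        then obtain y where y: "e = {w, y}" "y \<noteq> w"
          using edge2[of e] e by (auto simp: card_2_iff)
        then have "y = u"
          using acyclic_unique_neighbour[OF IH(5) acyc, of y w u] e uw
          by (auto simp: S_def insert_commute)
        then show ?thesis using y by simp
      next
        case False
        then show ?thesis using e by auto
      qed
    next
      fix e assume "e \<in> insert {w, u} {e \<in> edges T. e \<subseteq> S}"
      then show "e \<in> {e \<in> edges T. e \<subseteq> insert w S}" using uw by (auto simp: insert_commute)
    qed
    also have "{e \<in> edges T. e \<subseteq> S} = (\<lambda>i. {v' i, v' (par' i)}) ` {1..<j}"
      unfolding S_def IH(4)
    proof (intro image_cong refl)
      fix i assume i: "i \<in> {1..<j}"
      then have "par i < j" using IH(3) by (meson atLeastLessThan_iff less_trans)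
      then show "{v i, v (par i)} = {v' i, v' (par' i)}" using i by (simp add: v'_def par'_def)
    qed
    also have "insert {w, u} \<dots> = (\<lambda>i. {v' i, v' (par' i)}) ` {1..<Suc j}"
      using i0 Suc.hyps by (auto simp: v'_def par'_def atLeastLessThanSuc)
    finally have "{e \<in> edges T. e \<subseteq> v' ` {..<Suc j}} = (\<lambda>i. {v' i, v' (par' i)}) ` {1..<Suc j}"
      by (simp only: v'S)
    moreover have "path_connected_in T (v' ` {..<Suc j})"
      unfolding v'S using path_connected_in_insert[OF IH(5), of u w] uw by (simp add: S_def)
    moreover have "inj_on v' {..<Suc j}"
      using IH(1) uw(2) unfolding v'_def S_def lessThan_Suc by (auto simp: inj_on_def)
    moreover have "v' ` {..<Suc j} \<subseteq> verts T" using v'S uw \<open>S \<subseteq> verts T\<close> by auto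
    moreover have "\<forall>i\<in>{1..<Suc j}. par' i < i" using IH(3) i0 by (auto simp: par'_def)
    ultimately show ?case by blast
  qed
  have "1 \<le> t" using conn fin by (auto simp: connected_graph_def t_def Suc_le_eq card_gt_0_iff)
  then obtain v par where v: "inj_on v {..<t}" "v ` {..<t} \<subseteq> verts T" "\<forall>i\<in>{1..<t}. par i < i"
      "{e \<in> edges T. e \<subseteq> v ` {..<t}} = (\<lambda>i. {v i, v (par i)}) ` {1..<t}"
    using ex[OF \<open>1 \<le> t\<close> order.refl] by (elim exE conjE) (rule that)
  have vT: "v ` {..<t} = verts T"
    using v fin by (intro card_subset_eq) (auto simp: t_def card_image)
  have "edges T = (\<lambda>i. {v i, v (par i)}) ` {1..<t}" using v(4) edge2 unfolding vT by blast
  then show ?thesis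
    using v(1,3) vT unfolding t_def[symmetric] bij_betw_def by (intro exI[of _ v] exI[of _ par] conjI)
qed

subsection \<open>Tree factors from perfect matchings\<close>

lemma doubleton_eq_across:
  assumes "{a, b} = {c, d}" "a \<in> A" "c \<in> A" "b \<in> B" "d \<in> B" "A \<inter> B = {}"
  shows "a = c" "b = d"
  using assms by (auto simp: doubleton_eq_iff)

text \<open>For fixed \<open>k\<close>, composing the \<open>k\<close>-th matchings along the tree
  path from the root gives bijections \<open>f i\<close> from \<open>W 0\<close> to
  \<open>W i\<close>. Every \<open>x\<close> in \<open>W 0\<close> then carries a copy of
  \<open>T\<close> with vertices \<open>f i x\<close>. Bijectivity and disjointness of the classes
  make these copies vertex-disjoint. Acyclicity is essential here: each \<open>f i\<close> is
  prescribed by one parent only, so no consistency condition arises.\<close>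

lemma tree_factors_of_matchings:
  fixes T :: "'a ugraph" and G :: "'b ugraph" and W :: "nat \<Rightarrow> 'b set"
  defines "t \<equiv> card (verts T)"
  assumes v: "bij_betw v {..<t} (verts T)"
    and par: "\<And>i. 1 \<le> i \<Longrightarrow> i < t \<Longrightarrow> par i < i"
    and T: "edges T = (\<lambda>i. {v i, v (par i)}) ` {1..<t}"
    and t: "0 < t" and E: "E \<subseteq> edges G"
    and W: "(\<Union>i<t. W i) = verts G" "\<And>i. i < t \<Longrightarrow> finite (W i) \<and> card (W i) = m"
    and disj: "\<And>i j. i < t \<Longrightarrow> j < t \<Longrightarrow> i \<noteq> j \<Longrightarrow> W i \<inter> W j = {}"
    and bij: "\<And>i k. 1 \<le> i \<Longrightarrow> i < t \<Longrightarrow> k < r \<Longrightarrow> bij_betw (g i k) (W (par i)) (W i)"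
    and gE: "\<And>i k x. 1 \<le> i \<Longrightarrow> i < t \<Longrightarrow> k < r \<Longrightarrow> x \<in> W (par i) \<Longrightarrow> {x, g i k x} \<in> E"
    and ginj: "\<And>i x. 1 \<le> i \<Longrightarrow> i < t \<Longrightarrow> x \<in> W (par i) \<Longrightarrow> inj_on (\<lambda>k. g i k x) {..<r}"
  shows "\<exists>F. (\<forall>k<r. is_factor T G (F k) \<and> factor_edges (F k) \<subseteq> E \<and>
        card (factor_edges (F k)) = (t - 1) * m) \<and>
      (\<forall>k<r. \<forall>l<r. k \<noteq> l \<longrightarrow> factor_edges (F k) \<inter> factor_edges (F l) = {})"
proof -
  have class_unique: "i = j" if "x \<in> W i" "x \<in> W j" "i < t" "j < t" for x i j
    using disj[of i j] that by blast
  have part: "par i < t" "par i \<noteq> i" if "1 \<le> i" "i < t" for i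
    using par[OF that] that by auto
  define M where "M i k = (\<lambda>y. {y, g i k y}) ` W (par i)" for i k
  have Mmem: "\<exists>y y'. e = {y, y'} \<and> y \<in> W (par i) \<and> y' \<in> W i \<and> y' = g i k y"
    if "e \<in> M i k" "1 \<le> i" "i < t" "k < r" for e i k
    using that bij[of i k] by (auto simp: M_def bij_betw_def)
  \<comment> \<open>An edge determines the two classes it joins. These are \<open>par i\<close> and
    \<open>i\<close>, which determine \<open>i\<close>: a crossed coincidence would make each of two
    indices the parent of the other, although parents are smaller. With \<open>i\<close> known,
    \<open>ginj\<close> determines \<open>k\<close>.\<close>
  have M_disj: "i = i' \<and> k = k'" if e: "e \<in> M i k" "e \<in> M i' k'"
    and i: "1 \<le> i" "i < t" "1 \<le> i'" "i' < t" "k < r" "k' < r" for e i k i' k'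
  proof -
    obtain y y' where y: "e = {y, y'}" "y \<in> W (par i)" "y' \<in> W i" "y' = g i k y"
      using Mmem e i by blast
    obtain z z' where z: "e = {z, z'}" "z \<in> W (par i')" "z' \<in> W i'" "z' = g i' k' z"
      using Mmem e i by blast
    have "y = z \<and> y' = z' \<or> y = z' \<and> y' = z" using y(1) z(1) by (auto simp: doubleton_eq_iff)
    then have ii: "i = i'"
    proof
      assume "y = z \<and> y' = z'"
      then show ?thesis using y z class_unique i by metis
    next
      assume "y = z' \<and> y' = z"
      then have "par i = i'" "par i' = i" using y z class_unique i part by metis+
      then show ?thesis using par[of i] par[of i'] i by auto
    qed
    have "y = z" "y' = z'"
      using doubleton_eq_across[of y y' z z' "W (par i)" "W i"] y z i ii disj[of "par i" i] part by auto
    then have "g i k y = g i k' y" using y z ii by simp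
    then show ?thesis using inj_onD[OF ginj[of i y]] i ii y by auto
  qed
  have M_card: "card (M i k) = m" if i: "1 \<le> i" "i < t" "k < r" for i k
  proof -
    have "inj_on (\<lambda>y. {y, g i k y}) (W (par i))"
    proof (rule inj_onI)
      fix y z assume yz: "y \<in> W (par i)" "z \<in> W (par i)" "{y, g i k y} = {z, g i k z}"
      then have "g i k y \<in> W i" "g i k z \<in> W i" using bij[OF i] by (auto simp: bij_betw_def)
      then show "y = z" using doubleton_eq_across[OF yz(3)] yz disj[of "par i" i] part i by auto
    qed
    then show ?thesis using W(2)[of "par i"] part i by (simp add: M_def card_image)
  qed
  have ME: "M i k \<subseteq> E" if "1 \<le> i" "i < t" "k < r" for i k
    using gE that by (auto simp: M_def)
  have ex: "\<exists>F. is_factor T G F \<and> factor_edges F = (\<Union>i\<in>{1..<t}. M i k)" if k: "k < r" for k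
  proof -
    have "\<exists>f. (\<forall>i<j. bij_betw (f i) (W 0) (W i)) \<and> (\<forall>i\<in>{1..<j}. \<forall>x\<in>W 0. f i x = g i k (f (par i) x))"
      if "1 \<le> j" "j \<le> t" for j
      using that
    proof (induction j rule: nat_induct_at_least)
      case base
      then show ?case by (intro exI[of _ "\<lambda>_. id"]) (auto simp: bij_betw_def)
    next
      case (Suc j)
      then obtain f where f: "\<forall>i<j. bij_betw (f i) (W 0) (W i)"
        "\<forall>i\<in>{1..<j}. \<forall>x\<in>W 0. f i x = g i k (f (par i) x)" by auto
      have pj: "par j < j" using par[of j] Suc by auto
      have "bij_betw (g j k \<circ> f (par j)) (W 0) (W j)"
        using f pj bij[of j k] Suc k by (auto intro: bij_betw_trans)
      moreover have "\<forall>i\<in>{1..<j}. par i < j"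
        using par Suc.prems by (meson Suc_le_lessD atLeastLessThan_iff less_trans)
      ultimately show ?case
        using f pj by (intro exI[of _ "f(j := g j k \<circ> f (par j))"]) (auto simp: less_Suc_eq)
    qed
    from this[of t] obtain f where f0: "\<forall>i<t. bij_betw (f i) (W 0) (W i)"
      "\<forall>i\<in>{1..<t}. \<forall>x\<in>W 0. f i x = g i k (f (par i) x)" using t by (metis Suc_leI One_nat_def order.refl)
    have f: "bij_betw (f i) (W 0) (W i)" if "i < t" for i using f0(1) that by blast
    have f_rec: "f i x = g i k (f (par i) x)" if "1 \<le> i" "i < t" "x \<in> W 0" for i x
      using f0(2) that by simp
    have fW: "f i x \<in> W i" if "i < t" "x \<in> W 0" for i x using f[OF that(1)] that(2) by (auto simp: bij_betw_def)
    have f_eq: "i = i' \<and> x = x'" if "f i x = f i' x'" "i < t" "i' < t" "x \<in> W 0" "x' \<in> W 0" for i i' x x'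
    proof -
      have "i = i'" using class_unique[of "f i x" i i'] fW that by metis
      then show ?thesis using f[of i] that by (auto simp: bij_betw_def inj_on_def)
    qed
    define S where "S x = ((\<lambda>i. f i x) ` {..<t}, (\<lambda>i. {f i x, f (par i) x}) ` {1..<t})" for x
    have sub: "subgraph (S x) G" if x: "x \<in> W 0" for x
    proof -
      have "e \<in> E" if "e \<in> edges (S x)" for e
      proof -
        obtain i where i: "1 \<le> i" "i < t" "e = {f i x, f (par i) x}" using \<open>e \<in> edges (S x)\<close> by (auto simp: S_def)
        then show ?thesis using gE[OF i(1,2) k fW[OF part(1) x]] f_rec[OF i(1,2) x]
          by (simp add: insert_commute)
      qed
      moreover have "f i x \<noteq> f (par i) x" if "1 \<le> i" "i < t" for i
        using f_eq[of i x "par i" x] part[OF that] that x by metis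
      moreover have "f i x \<in> verts G" if "i < t" for i
        using fW[OF that x] W(1) that by blast
      ultimately show ?thesis
        unfolding subgraph_def simple_graph_def using E W(1) fW x part by (auto simp: S_def)
    qed
    have iso: "graph_iso T (S x)" if x: "x \<in> W 0" for x
    proof -
      define h where "h a = f (inv_into {..<t} v a) x" for a
      have hv: "h (v i) = f i x" if "i < t" for i
        using v that by (simp add: h_def bij_betw_def inv_into_f_f)
      have "inj_on (\<lambda>i. f i x) {..<t}" using f_eq x by (auto intro!: inj_onI)
      then have "bij_betw (\<lambda>i. f i x) {..<t} (verts (S x))" by (simp add: bij_betw_def S_def)
      then have "bij_betw (h \<circ> v) {..<t} (verts (S x))"
        using hv by (subst bij_betw_cong[where g = "\<lambda>i. f i x"]) auto
      then have "bij_betw h (verts T) (verts (S x))" using v bij_betw_comp_iff by blast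
      moreover have "(\<lambda>e. h ` e) ` edges T = edges (S x)"
        unfolding T S_def image_image snd_conv using hv part by (intro image_cong refl) auto
      ultimately show ?thesis unfolding graph_iso_def by blast
    qed
    have vdisj: "x = x'" if "verts (S x) \<inter> verts (S x') \<noteq> {}" "x \<in> W 0" "x' \<in> W 0" for x x'
      using that f_eq by (fastforce simp: S_def)
    have "inj_on S (W 0)"
    proof (rule inj_onI)
      fix x x' assume xx: "x \<in> W 0" "x' \<in> W 0" "S x = S x'"
      have "verts (S x) \<noteq> {}" using t by (auto simp: S_def lessThan_empty_iff)
      then show "x = x'" using vdisj[of x x'] xx by simp
    qed
    then have "card (S ` W 0) = m" using W(2) t by (simp add: card_image)
    moreover have "card (verts G) = t * m"
      unfolding W(1)[symmetric] using W(2) disj by (subst card_UN_disjoint) auto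
    moreover have "pairwise (\<lambda>S S'. verts S \<inter> verts S' = {}) (S ` W 0)"
      unfolding pairwise_def using vdisj by blast
    ultimately have "is_factor T G (S ` W 0)"
      unfolding is_factor_def using sub iso by (auto simp: t_def mult.commute)
    moreover have "factor_edges (S ` W 0) = (\<Union>i\<in>{1..<t}. M i k)"
    proof -
      have "factor_edges (S ` W 0) = (\<Union>i\<in>{1..<t}. (\<lambda>x. {f i x, f (par i) x}) ` W 0)"
        by (auto simp: factor_edges_def S_def)
      also have "\<dots> = (\<Union>i\<in>{1..<t}. (\<lambda>y. {y, g i k y}) ` f (par i) ` W 0)"
        using f_rec by (intro SUP_cong refl) (auto simp: image_image insert_commute intro!: image_cong)
      also have "\<dots> = (\<Union>i\<in>{1..<t}. M i k)"
        using f part by (intro SUP_cong refl) (auto simp: M_def bij_betw_def)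
      finally show ?thesis .
    qed
    ultimately show ?thesis by blast
  qed
  then obtain F where F: "\<And>k. k < r \<Longrightarrow> is_factor T G (F k) \<and> factor_edges (F k) = (\<Union>i\<in>{1..<t}. M i k)"
    by metis
  show ?thesis
  proof (intro exI[of _ F] conjI allI impI)
    show "is_factor T G (F k)" if "k < r" for k using F that by blast
    show "factor_edges (F k) \<subseteq> E" if "k < r" for k using F ME that by fastforce
    show "card (factor_edges (F k)) = (t - 1) * m" if "k < r" for k
    proof -
      have fin: "finite (M i k)" if "i \<in> {1..<t}" for i
        unfolding M_def using W(2) part that by auto
      have dis: "M i k \<inter> M j k = {}" if "i \<in> {1..<t}" "j \<in> {1..<t}" "i \<noteq> j" for i j
        using M_disj[of _ i k j k] that \<open>k < r\<close> by auto
      have "card (\<Union>i\<in>{1..<t}. M i k) = (\<Sum>i\<in>{1..<t}. card (M i k))"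
        using fin dis by (intro card_UN_disjoint) auto
      then show ?thesis using F M_card \<open>k < r\<close> by simp
    qed
    show "factor_edges (F k) \<inter> factor_edges (F l) = {}" if kl: "k < r" "l < r" "k \<noteq> l" for k l
      using F[OF kl(1)] F[OF kl(2)] M_disj kl by auto
  qed
qed

text \<open>The count is exact because all \<open>R * r\<close> factors have
  \<open>(t - 1) * m\<close> edges and share none: within one partition by disjointness of the
  matchings, between partitions because the sets \<open>E s\<close> are disjoint.\<close>

lemma packing_of_partitions:
  fixes T :: "'a ugraph" and G :: "'b ugraph" and W :: "nat \<Rightarrow> nat \<Rightarrow> 'b set"
  defines "t \<equiv> card (verts T)"
  assumes v: "bij_betw v {..<t} (verts T)"
    and par: "\<And>i. 1 \<le> i \<Longrightarrow> i < t \<Longrightarrow> par i < i"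
    and T: "edges T = (\<lambda>i. {v i, v (par i)}) ` {1..<t}"
    and t: "2 \<le> t" and m: "1 \<le> m" and G: "finite (edges G)"
    and E: "\<And>s. s < R \<Longrightarrow> E s \<subseteq> edges G"
      "\<And>s s'. s < R \<Longrightarrow> s' < R \<Longrightarrow> s \<noteq> s' \<Longrightarrow> E s \<inter> E s' = {}"
    and W: "\<And>s. s < R \<Longrightarrow> (\<Union>i<t. W s i) = verts G"
      "\<And>s i. s < R \<Longrightarrow> i < t \<Longrightarrow> finite (W s i) \<and> card (W s i) = m"
      "\<And>s i j. s < R \<Longrightarrow> i < t \<Longrightarrow> j < t \<Longrightarrow> i \<noteq> j \<Longrightarrow> W s i \<inter> W s j = {}"
    and cut: "\<And>s i. s < R \<Longrightarrow> 1 \<le> i \<Longrightarrow> i < t \<Longrightarrow>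
      cut_condition r (W s (par i)) (W s i) {(x, y) \<in> W s (par i) \<times> W s i. {x, y} \<in> E s}"
  shows "\<exists>C. edge_disjoint_factors T G C \<and>
    card (uncovered_edges G C) + R * r * ((t - 1) * m) = card (edges G)"
proof -
  have "\<exists>F. (\<forall>k<r. is_factor T G (F k) \<and> factor_edges (F k) \<subseteq> E s \<and>
        card (factor_edges (F k)) = (t - 1) * m) \<and>
      (\<forall>k<r. \<forall>l<r. k \<noteq> l \<longrightarrow> factor_edges (F k) \<inter> factor_edges (F l) = {})" if s: "s < R" for s
  proof -
    have "\<exists>g. (\<forall>k<r. bij_betw (g k) (W s (par i)) (W s i)) \<and>
        (\<forall>k<r. \<forall>x\<in>W s (par i). {x, g k x} \<in> E s) \<and>
        (\<forall>x\<in>W s (par i). inj_on (\<lambda>k. g k x) {..<r})" if i: "1 \<le> i" "i < t" for i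
    proof -
      have "par i < t" using par[OF i] i by simp
      then have fin: "finite (W s (par i))" "finite (W s i)" "card (W s (par i)) = card (W s i)"
        using W(2)[OF s] i by auto
      obtain g where "\<And>k. k < r \<Longrightarrow> bij_betw (g k) (W s (par i)) (W s i)"
        "\<And>k x. k < r \<Longrightarrow> x \<in> W s (par i) \<Longrightarrow> (x, g k x) \<in> {(x, y) \<in> W s (par i) \<times> W s i. {x, y} \<in> E s}"
        "\<And>x. x \<in> W s (par i) \<Longrightarrow> inj_on (\<lambda>k. g k x) {..<r}"
        using edge_disjoint_perfect_matchings[OF fin _ cut[OF s i]] by blast
      then show ?thesis by (intro exI[of _ g]) auto
    qed
    then obtain g where g: "\<And>i. 1 \<le> i \<Longrightarrow> i < t \<Longrightarrow> (\<forall>k<r. bij_betw (g i k) (W s (par i)) (W s i)) \<and>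
        (\<forall>k<r. \<forall>x\<in>W s (par i). {x, g i k x} \<in> E s) \<and>
        (\<forall>x\<in>W s (par i). inj_on (\<lambda>k. g i k x) {..<r})" by metis
    have W': "(\<Union>i<t. W s i) = verts G" "\<And>i. i < t \<Longrightarrow> finite (W s i) \<and> card (W s i) = m"
      "\<And>i j. i < t \<Longrightarrow> j < t \<Longrightarrow> i \<noteq> j \<Longrightarrow> W s i \<inter> W s j = {}"
      using W s by blast+
    have g': "\<And>i k. 1 \<le> i \<Longrightarrow> i < t \<Longrightarrow> k < r \<Longrightarrow> bij_betw (g i k) (W s (par i)) (W s i)"
      "\<And>i k x. 1 \<le> i \<Longrightarrow> i < t \<Longrightarrow> k < r \<Longrightarrow> x \<in> W s (par i) \<Longrightarrow> {x, g i k x} \<in> E s"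
      "\<And>i x. 1 \<le> i \<Longrightarrow> i < t \<Longrightarrow> x \<in> W s (par i) \<Longrightarrow> inj_on (\<lambda>k. g i k x) {..<r}"
      using g by blast+
    have "0 < t" using t by simp
    show ?thesis
      by (rule tree_factors_of_matchings[where v = v and par = par and W = "W s" and m = m and g = g
            and r = r and G = G and E = "E s" and T = T, folded t_def, OF v par T \<open>0 < t\<close> E(1)[OF s] W' g'])
  qed
  then obtain F where F: "\<And>s k. s < R \<Longrightarrow> k < r \<Longrightarrow> is_factor T G (F s k) \<and> factor_edges (F s k) \<subseteq> E s \<and>
        card (factor_edges (F s k)) = (t - 1) * m"
      "\<And>s k l. s < R \<Longrightarrow> k < r \<Longrightarrow> l < r \<Longrightarrow> k \<noteq> l \<Longrightarrow> factor_edges (F s k) \<inter> factor_edges (F s l) = {}"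
    by metis
  define I where "I = {..<R} \<times> {..<r}"
  define H where "H = (\<lambda>(s, k). factor_edges (F s k))"
  have disj: "H a \<inter> H b = {}" if aI: "a \<in> I" and bI: "b \<in> I" and ne: "a \<noteq> b" for a b
  proof -
    obtain s k s' k' where ab: "a = (s, k)" "b = (s', k')" "s < R" "s' < R" "k < r" "k' < r"
      using aI bI by (auto simp: I_def)
    show ?thesis
    proof (cases "s = s'")
      case True
      then show ?thesis using F(2)[of s k k'] ab ne by (simp add: H_def)
    next
      case False
      then show ?thesis using F(1)[of s k] F(1)[of s' k'] E(2)[of s s'] ab by (force simp: H_def)
    qed
  qed
  \<comment> \<open>Counting is done over the index set \<open>I\<close> through \<open>H\<close>,
    so no injectivity of the map from indices to factors has to be shown.\<close>
  define C where "C = (\<lambda>(s, k). F s k) ` I"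
  have "edge_disjoint_factors T G C"
    unfolding edge_disjoint_factors_def
  proof (intro conjI ballI)
    show "is_factor T G X" if "X \<in> C" for X using that F(1) by (auto simp: C_def I_def)
    show "pairwise (\<lambda>F F'. factor_edges F \<inter> factor_edges F' = {}) C"
      unfolding pairwise_def
    proof (intro ballI impI)
      fix X Y assume XY: "X \<in> C" "Y \<in> C" "X \<noteq> Y"
      then obtain a b where "a \<in> I" "b \<in> I" "X = case_prod F a" "Y = case_prod F b" by (auto simp: C_def)
      then show "factor_edges X \<inter> factor_edges Y = {}"
        using disj[of a b] XY(3) by (auto simp: H_def split: prod.splits)
    qed
  qed
  moreover have "card (uncovered_edges G C) + R * r * ((t - 1) * m) = card (edges G)"
  proof -
    have HG: "H a \<subseteq> edges G" if "a \<in> I" for a using that F(1) E(1) by (fastforce simp: H_def I_def)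
    have finI: "finite I" by (simp add: I_def)
    have "(\<Union>X\<in>C. factor_edges X) = (\<Union>a\<in>I. H a)" by (auto simp: C_def H_def)
    moreover have "card (\<Union>a\<in>I. H a) = R * r * ((t - 1) * m)"
    proof -
      have "card (\<Union>a\<in>I. H a) = (\<Sum>a\<in>I. card (H a))"
        using finI finite_subset[OF HG G] disj by (intro card_UN_disjoint) blast+
      also have "\<dots> = (\<Sum>a\<in>I. (t - 1) * m)" using F(1) by (intro sum.cong) (auto simp: H_def I_def)
      finally show ?thesis by (simp add: I_def)
    qed
    moreover have "(\<Union>a\<in>I. H a) \<subseteq> edges G" using HG by blast
    ultimately show ?thesis
      unfolding uncovered_edges_def using G
      by (metis card_Diff_subset card_mono finite_subset le_add_diff_inverse2)
  qed
  ultimately show ?thesis by blast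
qed

subsection \<open>Balanced families of equipartitions\<close>

lemma exists_le_average:
  fixes f :: "'a \<Rightarrow> real"
  assumes "finite A" "A \<noteq> {}" "(\<Sum>x\<in>A. f x) \<le> real (card A) * c"
  obtains x where "x \<in> A" "f x \<le> c"
proof (rule ccontr)
  assume "\<not> thesis"
  then have "\<And>x. x \<in> A \<Longrightarrow> c < f x" using that by force
  then have "(\<Sum>x\<in>A. c) < (\<Sum>x\<in>A. f x)" using assms by (intro sum_strict_mono)
  then show False using assms(3) by simp
qed

text \<open>Choosing the members of the family one at a time so as not to increase the expectation of
  \<open>\<Sum>e. (1 + \<epsilon>) ^ L e\<close>, where \<open>L e\<close> counts the members good for \<open>e\<close>, replaces a concentration
  argument for a random family.\<close>

lemma exists_balanced_family:
  fixes good :: "'p \<Rightarrow> 'e \<Rightarrow> bool" and q \<epsilon> :: real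
  assumes fin: "finite N" "finite P" "P \<noteq> {}" and \<epsilon>: "0 < \<epsilon>" and q: "0 \<le> q"
    and freq: "\<And>e. e \<in> N \<Longrightarrow> real (card {\<sigma> \<in> P. good \<sigma> e}) \<le> q * real (card P)"
  shows "\<exists>\<sigma>. (\<forall>s<R. \<sigma> s \<in> P) \<and>
    (\<Sum>e\<in>N. (1 + \<epsilon>) ^ card {s. s < R \<and> good (\<sigma> s) e}) \<le> real (card N) * (1 + \<epsilon> * q) ^ R"
proof (induction R)
  case 0
  then show ?case by simp
next
  case (Suc R)
  then obtain \<sigma> where \<sigma>: "\<forall>s<R. \<sigma> s \<in> P"
    "(\<Sum>e\<in>N. (1 + \<epsilon>) ^ card {s. s < R \<and> good (\<sigma> s) e}) \<le> real (card N) * (1 + \<epsilon> * q) ^ R" by blast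
  define w where "w e = (1 + \<epsilon>) ^ card {s. s < R \<and> good (\<sigma> s) e}" for e
  have w0: "0 \<le> w e" for e using \<epsilon> by (simp add: w_def)
  have "(\<Sum>\<tau>\<in>P. \<Sum>e\<in>N. w e * (1 + \<epsilon> * of_bool (good \<tau> e)))
      = (\<Sum>e\<in>N. \<Sum>\<tau>\<in>P. w e * (1 + \<epsilon> * of_bool (good \<tau> e)))" by (rule sum.swap)
  also have "\<dots> = (\<Sum>e\<in>N. w e * (real (card P) + \<epsilon> * real (card {\<tau> \<in> P. good \<tau> e})))"
  proof (rule sum.cong[OF refl])
    fix e
    have "(\<Sum>\<tau>\<in>P. of_bool (good \<tau> e) :: real) = real (card {\<tau> \<in> P. good \<tau> e})"
      using fin(2) by (simp add: of_bool_def sum.If_cases Int_def)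
    then show "(\<Sum>\<tau>\<in>P. w e * (1 + \<epsilon> * of_bool (good \<tau> e)))
        = w e * (real (card P) + \<epsilon> * real (card {\<tau> \<in> P. good \<tau> e}))"
      by (simp add: sum_distrib_left[symmetric] sum.distrib)
  qed
  also have "\<dots> \<le> (\<Sum>e\<in>N. w e * (real (card P) + \<epsilon> * (q * real (card P))))"
    using \<epsilon> w0 freq by (intro sum_mono mult_left_mono add_left_mono) auto
  also have "\<dots> = real (card P) * ((1 + \<epsilon> * q) * (\<Sum>e\<in>N. w e))"
    by (simp add: sum_distrib_left sum_distrib_right sum.distrib algebra_simps)
  finally obtain \<tau> where \<tau>: "\<tau> \<in> P" "(\<Sum>e\<in>N. w e * (1 + \<epsilon> * of_bool (good \<tau> e))) \<le> (1 + \<epsilon> * q) * (\<Sum>e\<in>N. w e)"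
    using exists_le_average[OF fin(2,3)] by blast
  let ?\<sigma> = "\<sigma>(R := \<tau>)"
  have weight: "(1 + \<epsilon>) ^ card {s. s < Suc R \<and> good (?\<sigma> s) e} = w e * (1 + \<epsilon> * of_bool (good \<tau> e))" for e
  proof -
    have "{s. s < Suc R \<and> good (?\<sigma> s) e} = {s. s < R \<and> good (\<sigma> s) e} \<union> (if good \<tau> e then {R} else {})"
      by (auto simp: less_Suc_eq)
    then show ?thesis by (auto simp: w_def card_insert_if)
  qed
  have "(\<Sum>e\<in>N. w e * (1 + \<epsilon> * of_bool (good \<tau> e))) \<le> (1 + \<epsilon> * q) * (real (card N) * (1 + \<epsilon> * q) ^ R)"
    using \<tau>(2) \<sigma>(2) \<epsilon> q by (smt (verit) mult_left_mono mult_nonneg_nonneg w_def sum.cong)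
  then show ?case
    using \<sigma>(1) \<tau>(1) weight by (intro exI[of _ ?\<sigma>]) (auto simp: less_Suc_eq algebra_simps)
qed

text \<open>One transposition moves \<open>a\<close> to \<open>c\<close>; a second moves the image
  of \<open>b\<close> to \<open>d\<close> and leaves \<open>c\<close> alone, since neither of the
  points it swaps is \<open>c\<close>.\<close>

lemma exists_permutation_between_pairs:
  assumes "e \<in> nsets A 2" "e' \<in> nsets A 2"
  obtains \<tau> where "\<tau> permutes A" "\<tau> ` e = e'"
proof -
  obtain a b where e: "e = {a, b}" "a \<noteq> b" "a \<in> A" "b \<in> A"
    using assms(1) by (auto simp: nsets_2_eq)
  obtain c d where e': "e' = {c, d}" "c \<noteq> d" "c \<in> A" "d \<in> A"
    using assms(2) by (auto simp: nsets_2_eq)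
  let ?t = "Transposition.transpose a c"
  have b: "?t b \<noteq> c" "?t b \<in> A" using e e' by (auto simp: Transposition.transpose_def)
  let ?\<tau> = "Transposition.transpose (?t b) d \<circ> ?t"
  have "?\<tau> permutes A" using e e' b by (intro permutes_compose permutes_swap_id)
  moreover have "?\<tau> ` e = e'" using e e' b by (auto simp: Transposition.transpose_apply_other)
  ultimately show thesis using that by blast
qed

lemma card_permutations_into:
  assumes A: "finite A" and D: "D \<subseteq> nsets A 2" and e: "e \<in> nsets A 2"
  shows "card {\<sigma>. \<sigma> permutes A \<and> \<sigma> ` e \<in> D} * card (nsets A 2) = card D * card {\<sigma>. \<sigma> permutes A}"
proof -
  let ?N = "nsets A 2" and ?P = "{\<sigma>. \<sigma> permutes A}"
  let ?K = "\<lambda>e. {\<sigma> \<in> ?P. \<sigma> ` e \<in> D}"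
  have finN: "finite ?N" and finP: "finite ?P"
    using A finite_imp_finite_nsets finite_permutations by auto
  have le: "card (?K e') \<le> card (?K e)" if N: "e \<in> ?N" "e' \<in> ?N" for e e'
  proof -
    obtain \<tau> where \<tau>: "\<tau> permutes A" "\<tau> ` e = e'" using exists_permutation_between_pairs[OF N] .
    have "inj_on (\<lambda>\<sigma>. \<sigma> \<circ> \<tau>) (?K e')"
      using permutes_surj[OF \<tau>(1)] by (intro inj_onI) (metis o_assoc permutes_inv_o(1)[OF \<tau>(1)] comp_id)
    moreover have "(\<lambda>\<sigma>. \<sigma> \<circ> \<tau>) ` ?K e' \<subseteq> ?K e"
      using \<tau> by (auto intro: permutes_compose simp: image_comp)
    ultimately show ?thesis using finP by (intro card_inj_on_le) auto
  qed
  have "(\<Sum>e'\<in>?N. card (?K e')) = (\<Sum>e'\<in>?N. card (?K e))"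
    using le e by (intro sum.cong refl order.antisym) auto
  also have "(\<Sum>e'\<in>?N. card (?K e')) = (\<Sum>\<sigma>\<in>?P. card {e' \<in> ?N. \<sigma> ` e' \<in> D})"
    using sum_multicount_gen[of ?N ?P "\<lambda>e' \<sigma>. \<sigma> ` e' \<in> D" "\<lambda>\<sigma>. card {e' \<in> ?N. \<sigma> ` e' \<in> D}"] finN finP by simp
  also have "\<dots> = (\<Sum>\<sigma>\<in>?P. card D)"
  proof (rule sum.cong[OF refl])
    fix \<sigma> assume "\<sigma> \<in> ?P"
    then have \<sigma>: "\<sigma> permutes A" by simp
    have "bij_betw (\<lambda>e. \<sigma> ` e) {e' \<in> ?N. \<sigma> ` e' \<in> D} D"
    proof (rule bij_betw_byWitness[where f' = "\<lambda>e. inv \<sigma> ` e"])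
      have inv: "inv \<sigma> permutes A" by (rule permutes_inv[OF \<sigma>])
      have ii: "\<sigma> ` inv \<sigma> ` x = x" "inv \<sigma> ` \<sigma> ` x = x" for x
        using permutes_inv_o[OF \<sigma>] by (simp_all add: image_comp)
      show "\<forall>a\<in>{e' \<in> ?N. \<sigma> ` e' \<in> D}. inv \<sigma> ` \<sigma> ` a = a" "\<forall>a'\<in>D. \<sigma> ` inv \<sigma> ` a' = a'"
        using ii by auto
      show "(`) \<sigma> ` {e' \<in> ?N. \<sigma> ` e' \<in> D} \<subseteq> D" by auto
      have "inv \<sigma> ` a \<in> ?N" if "a \<in> D" for a
      proof -
        have "a \<in> ?N" using that D by auto
        then have "inv \<sigma> ` a \<subseteq> inv \<sigma> ` A" "card (inv \<sigma> ` a) = 2" "finite (inv \<sigma> ` a)"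
          using permutes_inj[OF inv] by (auto simp: nsets_def card_image inj_on_subset)
        then show ?thesis using permutes_image[OF inv] by (simp add: nsets_def)
      qed
      then show "(`) (inv \<sigma>) ` D \<subseteq> {e' \<in> ?N. \<sigma> ` e' \<in> D}" using ii by auto
    qed
    then show "card {e' \<in> ?N. \<sigma> ` e' \<in> D} = card D" by (rule bij_betw_same_card)
  qed
  finally show ?thesis by (simp add: mult.commute)
qed

subsection \<open>Chernoff bounds for independent edges\<close>

text \<open>Independence factorises the moment generating function, and a factor
  \<open>1 + (exp s - 1) * prob\<close> is at most the exponential of its second term. The sign of
  \<open>s\<close> is free, so both tails are served. Values are of arbitrary type because edges
  will carry a colour besides their presence.\<close>

lemma expectation_exp_card_Pi_pmf:
  fixes s :: real and P :: "'e \<Rightarrow> 'x pmf" and Q :: "'e \<Rightarrow> 'x \<Rightarrow> bool"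
  assumes N: "finite N" and I: "I \<subseteq> N"
  shows "measure_pmf.expectation (Pi_pmf N d P) (\<lambda>\<omega>. exp (s * real (card {e \<in> I. Q e (\<omega> e)})))
    \<le> exp ((exp s - 1) * (\<Sum>e\<in>I. measure_pmf.prob (P e) {x. Q e x}))"
proof -
  define f where "f e x = (if e \<in> I \<and> Q e x then exp s else 1)" for e x
  have finI: "finite I" using N I finite_subset by blast
  have prod: "exp (s * real (card {e \<in> I. Q e (\<omega> e)})) = (\<Prod>e\<in>N. f e (\<omega> e))" for \<omega>
  proof -
    have "(\<Prod>e\<in>N. f e (\<omega> e)) = (\<Prod>e\<in>{e \<in> I. Q e (\<omega> e)}. exp s)"
      using N I by (intro prod.mono_neutral_cong_right) (auto simp: f_def)
    then show ?thesis by (simp add: exp_of_nat_mult[symmetric] mult.commute)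
  qed
  have "measure_pmf.expectation (Pi_pmf N d P) (\<lambda>\<omega>. \<Prod>e\<in>N. f e (\<omega> e))
      = (\<Prod>e\<in>N. measure_pmf.expectation (P e) (f e))"
    by (intro expectation_prod_Pi_pmf N measure_pmf.integrable_const_bound[where B = "max (exp s) 1"])
      (auto simp: f_def)
  also have "\<dots> \<le> (\<Prod>e\<in>N. if e \<in> I then exp ((exp s - 1) * measure_pmf.prob (P e) {x. Q e x}) else 1)"
  proof (rule prod_mono)
    fix e assume "e \<in> N"
    have f_eq: "f e = (\<lambda>x. if e \<in> I then 1 + (exp s - 1) * indicator {x. Q e x} x else 1)"
      by (auto simp: f_def fun_eq_iff)
    have "measure_pmf.expectation (P e) (f e) = (if e \<in> I then 1 + (exp s - 1) * measure_pmf.prob (P e) {x. Q e x} else 1)"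
      unfolding f_eq by (simp add: measure_pmf.prob_space measure_pmf.emeasure_eq_measure)
    also have "\<dots> \<le> (if e \<in> I then exp ((exp s - 1) * measure_pmf.prob (P e) {x. Q e x}) else 1)"
      by (simp add: exp_ge_add_one_self)
    finally show "0 \<le> measure_pmf.expectation (P e) (f e) \<and> measure_pmf.expectation (P e) (f e)
       \<le> (if e \<in> I then exp ((exp s - 1) * measure_pmf.prob (P e) {x. Q e x}) else 1)"
      by (auto intro!: Bochner_Integration.integral_nonneg simp: f_def)
  qed
  also have "\<dots> = (\<Prod>e\<in>I. exp ((exp s - 1) * measure_pmf.prob (P e) {x. Q e x}))"
    using N I by (intro prod.mono_neutral_cong_right) auto
  also have "\<dots> = exp ((exp s - 1) * (\<Sum>e\<in>I. measure_pmf.prob (P e) {x. Q e x}))"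
    using finI by (simp add: exp_sum sum_distrib_left)
  finally show ?thesis by (simp add: prod)
qed

lemma prob_exp_card_Pi_pmf_le:
  fixes s c :: real and P :: "'e \<Rightarrow> 'x pmf" and Q :: "'e \<Rightarrow> 'x \<Rightarrow> bool"
  assumes N: "finite N" and I: "I \<subseteq> N"
  shows "measure_pmf.prob (Pi_pmf N d P) {\<omega>. c \<le> s * real (card {e \<in> I. Q e (\<omega> e)})}
    \<le> exp ((exp s - 1) * (\<Sum>e\<in>I. measure_pmf.prob (P e) {x. Q e x}) - c)"
proof -
  let ?u = "\<lambda>\<omega>. exp (s * real (card {e \<in> I. Q e (\<omega> e)}))"
  have finI: "finite I" using N I finite_subset by blast
  have "norm (?u \<omega>) \<le> exp (\<bar>s\<bar> * real (card I))" for \<omega>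
  proof -
    have "s * real (card {e \<in> I. Q e (\<omega> e)}) \<le> \<bar>s\<bar> * real (card {e \<in> I. Q e (\<omega> e)})"
      by (intro mult_right_mono) auto
    also have "\<dots> \<le> \<bar>s\<bar> * real (card I)"
      using finI by (intro mult_left_mono) (auto intro: card_mono)
    finally show ?thesis by simp
  qed
  then have int: "integrable (measure_pmf (Pi_pmf N d P)) ?u"
    by (intro measure_pmf.integrable_const_bound[where B = "exp (\<bar>s\<bar> * real (card I))"]) auto
  have "measure_pmf.prob (Pi_pmf N d P) {\<omega>. exp c \<le> ?u \<omega>}
      \<le> measure_pmf.expectation (Pi_pmf N d P) ?u / exp c"
    using integral_Markov_inequality_measure[OF int, of UNIV "exp c"] by simp
  also have "\<dots> \<le> exp ((exp s - 1) * (\<Sum>e\<in>I. measure_pmf.prob (P e) {x. Q e x})) / exp c"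
    by (intro divide_right_mono expectation_exp_card_Pi_pmf N I) auto
  finally show ?thesis by (simp add: exp_diff)
qed

text \<open>The exponential bound with \<open>s = -\<epsilon>\<close>. As
  \<open>exp (-\<epsilon>) - 1\<close> is negative, a lower bound \<open>p\<close> on the
  probabilities is the right input, and the exponent becomes \<open>(-\<epsilon> + \<epsilon>^2 / 2)
  + \<epsilon> * (1 - \<epsilon>) = -\<epsilon>^2 / 2\<close> times the mean bound.\<close>

lemma chernoff_lower_Pi_pmf:
  fixes P :: "'e \<Rightarrow> 'x pmf" and Q :: "'e \<Rightarrow> 'x \<Rightarrow> bool"
  assumes N: "finite N" and I: "I \<subseteq> N" and \<epsilon>: "0 \<le> \<epsilon>"
    and p: "\<And>e. e \<in> I \<Longrightarrow> p \<le> measure_pmf.prob (P e) {x. Q e x}"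
  shows "measure_pmf.prob (Pi_pmf N d P) {\<omega>. real (card {e \<in> I. Q e (\<omega> e)}) \<le> (1 - \<epsilon>) * (p * real (card I))}
    \<le> exp (- (\<epsilon>\<^sup>2 * (p * real (card I)) / 2))"
proof (cases "p \<ge> 0 \<and> \<epsilon> > 0")
  case False
  then have "\<epsilon>\<^sup>2 * (p * real (card I)) \<le> 0"
    using \<epsilon> by (cases "\<epsilon> = 0") (simp_all add: mult_nonneg_nonpos mult_nonpos_nonneg)
  then have "1 \<le> exp (- (\<epsilon>\<^sup>2 * (p * real (card I)) / 2))" by simp
  then show ?thesis using measure_pmf.prob_le_1 order_trans by blast
next
  case True
  define \<mu> where "\<mu> = p * real (card I)"
  have mu0: "0 \<le> \<mu>" using True by (simp add: \<mu>_def)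
  have mu: "\<mu> \<le> (\<Sum>e\<in>I. measure_pmf.prob (P e) {x. Q e x})"
    unfolding \<mu>_def using p sum_mono[of I "\<lambda>_. p"] by (simp add: mult.commute)
  have expe: "exp (-\<epsilon>) - 1 \<le> - \<epsilon> + \<epsilon>\<^sup>2 / 2"
  proof -
    obtain t where t: "exp (-\<epsilon>) = (\<Sum>k<3. (-\<epsilon>) ^ k / fact k) + exp t / fact 3 * (-\<epsilon>) ^ 3"
      using Maclaurin_exp_le[of "-\<epsilon>" 3] by blast
    have "0 \<le> exp t / fact 3 * \<epsilon> ^ 3" using True by simp
    then have "exp t / fact 3 * (-\<epsilon>) ^ 3 \<le> 0" by simp
    then show ?thesis using t by (simp add: eval_nat_numeral)
  qed
  have "{\<omega>. real (card {e \<in> I. Q e (\<omega> e)}) \<le> (1 - \<epsilon>) * \<mu>}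
      = {\<omega>. - \<epsilon> * ((1 - \<epsilon>) * \<mu>) \<le> - \<epsilon> * real (card {e \<in> I. Q e (\<omega> e)})}"
    using True by (auto simp: mult_le_cancel_left)
  then have "measure_pmf.prob (Pi_pmf N d P) {\<omega>. real (card {e \<in> I. Q e (\<omega> e)}) \<le> (1 - \<epsilon>) * \<mu>}
      \<le> exp ((exp (- \<epsilon>) - 1) * (\<Sum>e\<in>I. measure_pmf.prob (P e) {x. Q e x}) - (- \<epsilon> * ((1 - \<epsilon>) * \<mu>)))"
    using prob_exp_card_Pi_pmf_le[OF N I, of d P "- \<epsilon> * ((1 - \<epsilon>) * \<mu>)" "- \<epsilon>" Q] by simp
  also have "\<dots> \<le> exp (- (\<epsilon>\<^sup>2 * \<mu> / 2))"
  proof -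
    have "(exp (- \<epsilon>) - 1) * (\<Sum>e\<in>I. measure_pmf.prob (P e) {x. Q e x}) \<le> (exp (- \<epsilon>) - 1) * \<mu>"
      using mu True by (intro mult_left_mono_neg) auto
    also have "\<dots> \<le> (- \<epsilon> + \<epsilon>\<^sup>2 / 2) * \<mu>" using expe mu0 by (rule mult_right_mono)
    finally show ?thesis by (simp add: algebra_simps power2_eq_square)
  qed
  finally show ?thesis by (simp add: \<mu>_def)
qed

text \<open>Here \<open>s = \<epsilon>\<close> and
  \<open>exp \<epsilon> - 1 \<le> \<epsilon> + \<epsilon>^2\<close>. The deviation is doubled to
  \<open>2 * \<epsilon>\<close> so that a full \<open>\<epsilon>^2\<close> remains after this crude
  estimate.\<close>

lemma chernoff_upper_Pi_pmf:
  fixes P :: "'e \<Rightarrow> 'x pmf" and Q :: "'e \<Rightarrow> 'x \<Rightarrow> bool"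
  assumes N: "finite N" and I: "I \<subseteq> N" and \<epsilon>: "0 < \<epsilon>" "\<epsilon> \<le> 1"
    and p: "\<And>e. e \<in> I \<Longrightarrow> measure_pmf.prob (P e) {x. Q e x} \<le> p"
  shows "measure_pmf.prob (Pi_pmf N d P) {\<omega>. (1 + 2 * \<epsilon>) * (p * real (card I)) \<le> real (card {e \<in> I. Q e (\<omega> e)})}
    \<le> exp (- (\<epsilon>\<^sup>2 * (p * real (card I))))"
proof -
  define \<mu> where "\<mu> = p * real (card I)"
  have mu: "(\<Sum>e\<in>I. measure_pmf.prob (P e) {x. Q e x}) \<le> \<mu>"
    unfolding \<mu>_def using p sum_mono[of I _ "\<lambda>_. p"] by (simp add: mult.commute)
  have mu0: "0 \<le> \<mu>" using mu sum_nonneg[of I "\<lambda>e. measure_pmf.prob (P e) {x. Q e x}"] by simp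
  have expe: "exp \<epsilon> - 1 \<le> \<epsilon> + \<epsilon>\<^sup>2" using exp_bound[of \<epsilon>] \<epsilon> by simp
  have "{\<omega>. (1 + 2 * \<epsilon>) * \<mu> \<le> real (card {e \<in> I. Q e (\<omega> e)})}
      = {\<omega>. \<epsilon> * ((1 + 2 * \<epsilon>) * \<mu>) \<le> \<epsilon> * real (card {e \<in> I. Q e (\<omega> e)})}"
    using \<epsilon> by (simp add: mult_le_cancel_left)
  then have "measure_pmf.prob (Pi_pmf N d P) {\<omega>. (1 + 2 * \<epsilon>) * \<mu> \<le> real (card {e \<in> I. Q e (\<omega> e)})}
      \<le> exp ((exp \<epsilon> - 1) * (\<Sum>e\<in>I. measure_pmf.prob (P e) {x. Q e x}) - \<epsilon> * ((1 + 2 * \<epsilon>) * \<mu>))"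
    using prob_exp_card_Pi_pmf_le[OF N I, of d P "\<epsilon> * ((1 + 2 * \<epsilon>) * \<mu>)" \<epsilon> Q] by simp
  also have "\<dots> \<le> exp (- (\<epsilon>\<^sup>2 * \<mu>))"
  proof -
    have "(exp \<epsilon> - 1) * (\<Sum>e\<in>I. measure_pmf.prob (P e) {x. Q e x}) \<le> (exp \<epsilon> - 1) * \<mu>"
      using mu \<epsilon> by (intro mult_left_mono) auto
    also have "\<dots> \<le> (\<epsilon> + \<epsilon>\<^sup>2) * \<mu>" using expe mu0 by (rule mult_right_mono)
    finally show ?thesis by (simp add: algebra_simps power2_eq_square)
  qed
  finally show ?thesis by (simp add: \<mu>_def)
qed

section \<open>The cut condition in random bipartite graphs\<close>

lemma sum_power_card_Pow:
  fixes z :: real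
  assumes "finite X"
  shows "(\<Sum>A\<in>Pow X. z ^ card A) = (1 + z) ^ card X"
  using assms
proof (induction X)
  case empty
  then show ?case by simp
next
  case (insert x X)
  have inj: "inj_on (insert x) (Pow X)" using insert.hyps by (auto simp: inj_on_def)
  have "(\<Sum>A\<in>Pow (insert x X). z ^ card A) = (\<Sum>A\<in>Pow X. z ^ card A) + (\<Sum>A\<in>insert x ` Pow X. z ^ card A)"
    unfolding Pow_insert using insert.hyps by (intro sum.union_disjoint) auto
  also have "(\<Sum>A\<in>insert x ` Pow X. z ^ card A) = (\<Sum>A\<in>Pow X. z * z ^ card A)"
    unfolding sum.reindex[OF inj] o_def
  proof (rule sum.cong[OF refl])
    fix A assume "A \<in> Pow X"
    then have "x \<notin> A" "finite A" using insert.hyps finite_subset by auto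
    then show "z ^ card (insert x A) = z * z ^ card A" by simp
  qed
  finally show ?case using insert by (simp add: sum_distrib_left[symmetric] algebra_simps)
qed

lemma sum_power_card_diff_Pow:
  fixes z :: real
  assumes X: "finite X"
  shows "(\<Sum>A\<in>Pow X. z ^ (card X - card A)) = (1 + z) ^ card X"
proof -
  have "(\<Sum>A\<in>Pow X. z ^ (card X - card A)) = (\<Sum>A\<in>Pow X. z ^ card A)"
    by (rule sum.reindex_bij_witness[where i = "\<lambda>A. X - A" and j = "\<lambda>A. X - A"])
      (use X in \<open>auto simp: card_Diff_subset[OF finite_subset[OF _ X]] double_diff\<close>)
  then show ?thesis using sum_power_card_Pow[OF X] by simp
qed

text \<open>Pairs with \<open>card A + card B \<le> m\<close> meet the cut condition trivially. For
  the others, with sizes \<open>a\<close> and \<open>b\<close>,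
  \<open>(m - a) * (m - b) \<ge> 0\<close> says \<open>a * b \<ge> m * (a + b - m)\<close>, so edge
  density \<open>(1 - \<epsilon>) * p\<close> yields \<open>r * (a + b - m)\<close> edges.\<close>

lemma cut_condition_if_expanding:
  fixes p \<epsilon> :: real
  assumes fin: "finite X" "finite Y" "card X = m" "card Y = m"
    and r: "real r \<le> (1 - \<epsilon>) * p * m" "0 \<le> (1 - \<epsilon>) * p"
    and exp: "\<And>A B. A \<subseteq> X \<Longrightarrow> B \<subseteq> Y \<Longrightarrow> m < card A + card B \<Longrightarrow>
      (1 - \<epsilon>) * (p * (real (card A) * real (card B))) \<le> real (card (E \<inter> A \<times> B))"
  shows "cut_condition r X Y E"
  unfolding cut_condition_def
proof (intro allI impI)
  fix A B assume AB: "A \<subseteq> X" "B \<subseteq> Y"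
  show "r * (card A + card B) \<le> card (E \<inter> A \<times> B) + r * card X"
  proof (cases "m < card A + card B")
    case False
    then show ?thesis using fin by (intro trans_le_add2 mult_left_mono) auto
  next
    case True
    let ?a = "real (card A)" and ?b = "real (card B)"
    have le: "?a \<le> m" "?b \<le> m"
      using card_mono[OF fin(1) AB(1)] card_mono[OF fin(2) AB(2)] fin by auto
    have "0 \<le> (m - ?a) * (m - ?b)" using le by simp
    then have "m * (?a + ?b - m) \<le> ?a * ?b" by (simp add: algebra_simps)
    then have "(1 - \<epsilon>) * p * (m * (?a + ?b - m)) \<le> (1 - \<epsilon>) * p * (?a * ?b)"
      using r(2) by (intro mult_left_mono)
    also have "\<dots> \<le> real (card (E \<inter> A \<times> B))" using exp[OF AB True] by (simp add: mult.assoc)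
    finally have "(1 - \<epsilon>) * p * m * (?a + ?b - m) \<le> real (card (E \<inter> A \<times> B))" by (simp add: mult.assoc)
    moreover have "real r * (?a + ?b - m) \<le> (1 - \<epsilon>) * p * m * (?a + ?b - m)"
      using r(1) True by (intro mult_right_mono) auto
    ultimately have "real r * (?a + ?b) \<le> real (card (E \<inter> A \<times> B)) + real r * m"
      by (simp add: algebra_simps)
    then have "real (r * (card A + card B)) \<le> real (card (E \<inter> A \<times> B) + r * m)" by simp
    then show ?thesis using fin by (simp only: of_nat_le_iff)
  qed
qed

lemma one_plus_power_bound:
  fixes z :: real
  assumes "0 \<le> z" "real m * z \<le> 1"
  shows "((1 + z) ^ m - 1) * (1 + z) ^ m \<le> 6 * (real m * z)"
proof -
  let ?u = "real m * z"
  have "(1 + z) ^ m \<le> exp z ^ m" using assms by (intro power_mono exp_ge_add_one_self) auto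
  then have u: "(1 + z) ^ m \<le> exp ?u" by (simp add: exp_of_nat_mult)
  also have "exp ?u \<le> 1 + ?u + ?u\<^sup>2" using assms by (intro exp_bound) auto
  also have "?u\<^sup>2 \<le> ?u" using assms by (simp add: power2_eq_square mult_left_le)
  finally have le: "(1 + z) ^ m \<le> 1 + 2 * ?u" by (simp add: mult.commute)
  have "((1 + z) ^ m - 1) * (1 + z) ^ m \<le> (2 * ?u) * 3"
    using le assms by (intro mult_mono) auto
  then show ?thesis by simp
qed

text \<open>Since \<open>card A + card B > m\<close>, the larger of the two sets, say \<open>A\<close>, has more than \<open>m / 2\<close>
  elements and misses fewer than \<open>card B\<close> elements of \<open>X\<close>; this pays for the number of pairs.\<close>

lemma exp_expansion_le:
  fixes h :: real
  assumes ab: "m < a + b" "a \<le> m" "b \<le> m" and h: "0 \<le> h"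
  shows "exp (- (4 * (h * (real a * real b)))) \<le>
    exp (- (h * m)) ^ b * exp (- (h * m)) ^ (m - a) + exp (- (h * m)) ^ a * exp (- (h * m)) ^ (m - b)"
proof -
  have aux: "exp (- (4 * (h * (real a * real b)))) \<le> exp (- (h * m)) ^ b * exp (- (h * m)) ^ (m - a)"
    if ab: "m < a + b" "a \<le> m" "b \<le> a" for a b
  proof -
    have "real b + real (m - a) \<le> 2 * real b" using ab by linarith
    then have "(real b + real (m - a)) * m \<le> (2 * real b) * m" by (intro mult_right_mono) auto
    also have "\<dots> \<le> (2 * real b) * (2 * real a)" using ab by (intro mult_left_mono) linarith+
    finally have "h * ((real b + real (m - a)) * m) \<le> h * ((2 * real b) * (2 * real a))"
      using h by (rule mult_left_mono)
    then show ?thesis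
      by (simp add: exp_of_nat_mult[symmetric] exp_add[symmetric] algebra_simps)
  qed
  show ?thesis
  proof (cases "b \<le> a")
    case True
    then show ?thesis using aux[of a b] ab by (smt (verit) exp_gt_zero zero_less_power mult_pos_pos)
  next
    case False
    then show ?thesis using aux[of b a] ab
      by (smt (verit) add.commute exp_gt_zero mult.commute mult_pos_pos nat_le_linear zero_less_power)
  qed
qed

text \<open>A union bound over pairs \<open>(A, B)\<close>. Chernoff's exponent
  \<open>\<epsilon>^2 * p / 2\<close> is written as four times \<open>\<epsilon>^2 * p / 8\<close>
  to fit \<open>exp_expansion_le\<close>, which replaces a function of
  \<open>card A * card B\<close> by products of a term in \<open>A\<close> and a term in
  \<open>B\<close>. The double sum then factorises, and each of its two halves is at most
  \<open>6 * (real m * z)\<close>.\<close>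

lemma prob_not_expanding_le:
  fixes P :: "'a set \<Rightarrow> 'x pmf" and Q :: "'a set \<Rightarrow> 'x \<Rightarrow> bool" and p \<epsilon> :: real
  assumes N: "finite N" and XY: "finite X" "finite Y" "card X = m" "card Y = m" "X \<inter> Y = {}"
    and sub: "\<And>x y. x \<in> X \<Longrightarrow> y \<in> Y \<Longrightarrow> {x, y} \<in> N"
    and p: "0 \<le> p" "\<And>x y. x \<in> X \<Longrightarrow> y \<in> Y \<Longrightarrow> p \<le> measure_pmf.prob (P {x, y}) {v. Q {x, y} v}"
    and \<epsilon>: "0 \<le> \<epsilon>" and z: "z = exp (- (\<epsilon>\<^sup>2 * p / 8 * m))" "real m * z \<le> 1"
  shows "measure_pmf.prob (Pi_pmf N d P) {\<omega>. \<exists>A B. A \<subseteq> X \<and> B \<subseteq> Y \<and> m < card A + card B \<and>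
      real (card ({(x, y) \<in> X \<times> Y. Q {x, y} (\<omega> {x, y})} \<inter> A \<times> B))
        < (1 - \<epsilon>) * (p * (real (card A) * real (card B)))} \<le> 12 * (real m * z)"
    (is "measure_pmf.prob _ ?Bad \<le> _")
proof -
  define bad where "bad = (\<lambda>(A, B). {\<omega>. real (card ({(x, y) \<in> X \<times> Y. Q {x, y} (\<omega> {x, y})} \<inter> A \<times> B))
        < (1 - \<epsilon>) * (p * (real (card A) * real (card B)))})"
  define S where "S = {(A, B). A \<subseteq> X \<and> B \<subseteq> Y \<and> m < card A + card B}"
  have S_sub: "S \<subseteq> Pow X \<times> Pow Y" by (auto simp: S_def)
  have finPP: "finite (Pow X \<times> Pow Y)" using XY by simp
  have finS: "finite S" using S_sub finPP by (rule finite_subset)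
  have z0: "0 < z" by (simp add: z)
  \<comment> \<open>The indicators are harmless on \<open>S\<close>, where both sets are nonempty,
    but decisive after the sum is extended to all subsets: they turn one factor
    \<open>(1 + z) ^ m\<close> into the small \<open>(1 + z) ^ m - 1\<close>.\<close>
  let ?w = "\<lambda>(A, B). z ^ card B * z ^ (m - card A) * of_bool (B \<noteq> {}) + z ^ card A * z ^ (m - card B) * of_bool (A \<noteq> {})"
  have bad_le: "measure_pmf.prob (Pi_pmf N d P) (bad AB) \<le> ?w AB" if AB_S: "AB \<in> S" for AB
  proof -
    obtain A B where AB: "AB = (A, B)" "A \<subseteq> X" "B \<subseteq> Y" "m < card A + card B"
      using AB_S by (auto simp: S_def)
    have le: "card A \<le> m" "card B \<le> m"
      using card_mono[OF XY(1) AB(2)] card_mono[OF XY(2) AB(3)] XY by auto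
    then have ne: "A \<noteq> {}" "B \<noteq> {}" using AB(4) by auto
    define I where "I = (\<lambda>(x, y). {x, y}) ` (A \<times> B)"
    have inj: "inj_on (\<lambda>(x, y). {x, y}) (A \<times> B)"
      using AB XY(5) by (auto simp: inj_on_def doubleton_eq_iff)
    have cI: "real (card I) = real (card A) * real (card B)"
      using inj by (simp add: I_def card_image card_cartesian_product)
    have "card ({(x, y) \<in> X \<times> Y. Q {x, y} (\<omega> {x, y})} \<inter> A \<times> B) = card {e \<in> I. Q e (\<omega> e)}" for \<omega>
    proof -
      have "{e \<in> I. Q e (\<omega> e)} = (\<lambda>(x, y). {x, y}) ` ({(x, y) \<in> X \<times> Y. Q {x, y} (\<omega> {x, y})} \<inter> A \<times> B)"
        using AB by (auto simp: I_def)
      then show ?thesis using inj_on_subset[OF inj] by (simp add: card_image)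
    qed
    then have "bad AB \<subseteq> {\<omega>. real (card {e \<in> I. Q e (\<omega> e)}) \<le> (1 - \<epsilon>) * (p * real (card I))}"
      by (auto simp: bad_def AB(1) cI)
    then have "measure_pmf.prob (Pi_pmf N d P) (bad AB)
        \<le> measure_pmf.prob (Pi_pmf N d P) {\<omega>. real (card {e \<in> I. Q e (\<omega> e)}) \<le> (1 - \<epsilon>) * (p * real (card I))}"
      by (intro measure_pmf.finite_measure_mono) auto
    also have "\<dots> \<le> exp (- (\<epsilon>\<^sup>2 * (p * real (card I)) / 2))"
    proof (rule chernoff_lower_Pi_pmf[OF N _ \<epsilon>])
      show "I \<subseteq> N" using sub AB(2,3) by (fastforce simp: I_def)
      show "p \<le> measure_pmf.prob (P e) {v. Q e v}" if e: "e \<in> I" for e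
      proof -
        obtain x y where "x \<in> A" "y \<in> B" "e = {x, y}" using e by (auto simp: I_def)
        then show ?thesis using p(2)[of x y] AB(2,3) by blast
      qed
    qed
    also have "\<dots> = exp (- (4 * (\<epsilon>\<^sup>2 * p / 8 * (real (card A) * real (card B)))))" by (simp add: cI)
    also have "\<dots> \<le> z ^ card B * z ^ (m - card A) + z ^ card A * z ^ (m - card B)"
      unfolding z(1) using AB(4) le p(1) by (intro exp_expansion_le) auto
    finally show ?thesis using ne by (simp add: AB(1))
  qed
  have zX: "(\<Sum>A\<in>Pow X. z ^ (m - card A)) = (1 + z) ^ m" and zY: "(\<Sum>B\<in>Pow Y. z ^ (m - card B)) = (1 + z) ^ m"
    using sum_power_card_diff_Pow XY by metis+
  have nonempty: "(\<Sum>A\<in>Pow Z. z ^ card A * of_bool (A \<noteq> {})) = (1 + z) ^ m - 1"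
    if "finite Z" "card Z = m" for Z :: "'a set"
  proof -
    have "(\<Sum>A\<in>Pow Z. z ^ card A * of_bool (A \<noteq> {})) = (\<Sum>A\<in>Pow Z - {{}}. z ^ card A)"
      using that by (intro sum.mono_neutral_cong_right) auto
    also have "\<dots> = (\<Sum>A\<in>Pow Z. z ^ card A) - 1"
      using that by (subst sum_diff1) auto
    finally show ?thesis using sum_power_card_Pow[OF that(1), of z] that(2) by simp
  qed
  have "?Bad = (\<Union>AB\<in>S. bad AB)" by (auto simp: S_def bad_def)
  then have "measure_pmf.prob (Pi_pmf N d P) ?Bad \<le> (\<Sum>AB\<in>S. measure_pmf.prob (Pi_pmf N d P) (bad AB))"
    using measure_pmf.finite_measure_subadditive_finite[OF finS, of bad "Pi_pmf N d P"] by simp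
  also have "\<dots> \<le> (\<Sum>AB\<in>S. ?w AB)" using bad_le by (rule sum_mono)
  also have "\<dots> \<le> (\<Sum>AB\<in>Pow X \<times> Pow Y. ?w AB)"
    using S_sub z0 by (intro sum_mono2 finPP) auto
  also have "\<dots> = (\<Sum>A\<in>Pow X. \<Sum>B\<in>Pow Y. ?w (A, B))"
    unfolding sum.cartesian_product by simp
  also have "\<dots> = (\<Sum>A\<in>Pow X. \<Sum>B\<in>Pow Y. z ^ (m - card A) * (z ^ card B * of_bool (B \<noteq> {})))
      + (\<Sum>A\<in>Pow X. \<Sum>B\<in>Pow Y. (z ^ card A * of_bool (A \<noteq> {})) * z ^ (m - card B))"
    unfolding sum.distrib[symmetric] by (intro sum.cong refl) (simp add: mult_ac)
  also have "\<dots> = (1 + z) ^ m * ((1 + z) ^ m - 1) + ((1 + z) ^ m - 1) * (1 + z) ^ m"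
    unfolding sum_product[symmetric] zX zY nonempty[OF XY(1,3)] nonempty[OF XY(2,4)] ..
  also have "\<dots> \<le> 12 * (real m * z)"
    using one_plus_power_bound[of z m] z0 z(2) by (simp add: mult.commute)
  finally show ?thesis .
qed

subsection \<open>Tree factors in the random graph\<close>

definition block :: "nat \<Rightarrow> nat \<Rightarrow> nat set" where
  "block m i = {x. i * m \<le> x \<and> x < Suc i * m}"

lemma mem_block_iff: "0 < m \<Longrightarrow> x \<in> block m i \<longleftrightarrow> x div m = i"
  using dividend_less_div_times[of m x]
  by (auto simp: block_def mult.commute intro: div_nat_eqI)

lemma finite_block [simp]: "finite (block m i)" and card_block [simp]: "card (block m i) = m"
proof -
  have "block m i = {i * m..<Suc i * m}" by (auto simp: block_def)
  then show "finite (block m i)" "card (block m i) = m" by auto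
qed

lemma block_disjoint: "0 < m \<Longrightarrow> i \<noteq> j \<Longrightarrow> block m i \<inter> block m j = {}"
  by (auto simp: mem_block_iff)

lemma UN_block: "0 < m \<Longrightarrow> (\<Union>i<t. block m i) = {..<t * m}"
  by (auto simp: mem_block_iff less_mult_imp_div_less) (metis dividend_less_times_div div_less_iff_less_mult)

definition tree_pairs :: "nat \<Rightarrow> nat \<Rightarrow> (nat \<Rightarrow> nat) \<Rightarrow> nat set set" where
  "tree_pairs t m par = (\<Union>i\<in>{1..<t}. (\<lambda>(x, y). {x, y}) ` (block m (par i) \<times> block m i))"

lemma
  assumes m: "0 < m" and par: "\<And>i. 1 \<le> i \<Longrightarrow> i < t \<Longrightarrow> par i < i"
  shows tree_pairs_subset: "tree_pairs t m par \<subseteq> nsets {..<t * m} 2"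
    and card_tree_pairs: "card (tree_pairs t m par) = (t - 1) * (m * m)"
proof -
  let ?S = "\<lambda>i. (\<lambda>(x, y). {x, y}) ` (block m (par i) \<times> block m i)"
  show "tree_pairs t m par \<subseteq> nsets {..<t * m} 2"
  proof
    fix e assume "e \<in> tree_pairs t m par"
    then obtain i x y where i: "1 \<le> i" "i < t" "e = {x, y}" "x \<in> block m (par i)" "y \<in> block m i"
      by (auto simp: tree_pairs_def)
    have "par i < i" using par i by blast
    moreover have "x \<in> (\<Union>i<t. block m i)" "y \<in> (\<Union>i<t. block m i)" using i \<open>par i < i\<close> by auto
    moreover have "x \<noteq> y" using i \<open>par i < i\<close> mem_block_iff[OF m] by auto
    ultimately show "e \<in> nsets {..<t * m} 2" using i UN_block[OF m] by auto
  qed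
  have card_S: "card (?S i) = m * m" if i: "i \<in> {1..<t}" for i
  proof -
    have "par i \<noteq> i" using par[of i] i by auto
    then have "inj_on (\<lambda>(x, y). {x, y}) (block m (par i) \<times> block m i)"
      by (auto simp: inj_on_def doubleton_eq_iff mem_block_iff[OF m])
    then show ?thesis by (simp add: card_image card_cartesian_product)
  qed
  have disj_S: "?S i \<inter> ?S j = {}" if ij: "i \<in> {1..<t}" "j \<in> {1..<t}" "i \<noteq> j" for i j
  proof -
    have lt: "par i < i" "par j < j" using par ij by auto
    show ?thesis
    proof (rule equals0I)
      fix e assume "e \<in> ?S i \<inter> ?S j"
      then have e: "e \<in> ?S i" "e \<in> ?S j" by (simp_all only: Int_iff)
      obtain x y where xy: "e = {x, y}" "x \<in> block m (par i)" "y \<in> block m i" using e(1) by (elim imageE SigmaE) simp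
      obtain x' y' where xy': "e = {x', y'}" "x' \<in> block m (par j)" "y' \<in> block m j" using e(2) by (elim imageE SigmaE) simp
      have "x = x' \<and> y = y' \<or> x = y' \<and> y = x'"
        using xy(1) xy'(1) by (auto simp: doubleton_eq_iff)
      then show False
      proof
        assume "x = x' \<and> y = y'"
        then show False using xy(3) xy'(3) ij(3) by (simp add: mem_block_iff[OF m])
      next
        assume "x = y' \<and> y = x'"
        then have "par i = j" "par j = i"
          using xy(2,3) xy'(2,3) unfolding mem_block_iff[OF m] by metis+
        then show False using lt by linarith
      qed
    qed
  qed
  have "card (tree_pairs t m par) = (\<Sum>i\<in>{1..<t}. card (?S i))"
    unfolding tree_pairs_def
  proof (rule card_UN_disjoint)
    show "\<forall>i\<in>{1..<t}. finite (?S i)" by (intro ballI finite_imageI finite_SigmaI finite_block)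
    show "\<forall>i\<in>{1..<t}. \<forall>j\<in>{1..<t}. i \<noteq> j \<longrightarrow> ?S i \<inter> ?S j = {}" by (intro ballI impI disj_S)
  qed simp
  also have "\<dots> = (\<Sum>i\<in>{1..<t}. m * m)" by (rule sum.cong[OF refl card_S])
  finally show "card (tree_pairs t m par) = (t - 1) * (m * m)" by simp
qed

lemma card_nsets_2: "real (card (nsets {..<n} 2)) = real n * (real n - 1) / 2"
proof -
  have "card (nsets {..<n} 2) = n choose 2"
    using binomial_eq_nsets[of n 2] by (simp add: atLeast0LessThan)
  then show ?thesis
    by (cases n) (simp_all add: choose_two real_of_nat_div algebra_simps)
qed

text \<open>A single term of the weight sum is at most the whole, hence
  \<open>(1 + \<epsilon>) ^ l \<le> n^2 * exp (\<epsilon> * q * R)\<close>. After taking logarithms,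
  the size of \<open>R\<close> absorbs \<open>2 * ln n\<close> at the price of one factor
  \<open>1 + \<epsilon>\<close>; the estimate
  \<open>ln (1 + \<epsilon>) \<ge> \<epsilon> / (1 + \<epsilon>)\<close> costs the other.\<close>

lemma exists_balanced_permutations:
  fixes \<epsilon> :: real
  assumes n: "2 \<le> n" and D: "D \<subseteq> nsets {..<n} 2" and \<epsilon>: "0 < \<epsilon>"
    and q: "q = real (card D) / real (card (nsets {..<n} 2))"
    and R: "2 * ln (real n) \<le> \<epsilon>\<^sup>2 * q * real R"
  obtains \<sigma> where "\<And>s. s < R \<Longrightarrow> \<sigma> s permutes {..<n}"
    "\<And>e. e \<in> nsets {..<n} 2 \<Longrightarrow> real (card {s. s < R \<and> \<sigma> s ` e \<in> D}) \<le> (1 + \<epsilon>)\<^sup>2 * q * real R"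
proof -
  let ?N = "nsets {..<n} 2" and ?P = "{\<sigma>. \<sigma> permutes {..<n}}"
  have cN: "0 < real (card ?N)" using n by (simp add: card_nsets_2)
  have q0: "0 \<le> q" by (simp add: q)
  have freq: "real (card {\<sigma> \<in> ?P. \<sigma> ` e \<in> D}) \<le> q * real (card ?P)" if "e \<in> ?N" for e
  proof -
    have "{\<sigma> \<in> ?P. \<sigma> ` e \<in> D} = {\<sigma>. \<sigma> permutes {..<n} \<and> \<sigma> ` e \<in> D}" by simp
    then have "card {\<sigma> \<in> ?P. \<sigma> ` e \<in> D} * card ?N = card D * card ?P"
      using card_permutations_into[OF finite_lessThan D that] by simp
    then have "real (card {\<sigma> \<in> ?P. \<sigma> ` e \<in> D}) * real (card ?N) = real (card D) * real (card ?P)"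
      by (simp only: of_nat_mult[symmetric])
    then show ?thesis using cN by (simp add: q field_simps)
  qed
  have "finite ?N" "finite ?P" "?P \<noteq> {}"
    by (auto simp: finite_imp_finite_nsets finite_permutations intro: permutes_id)
  from exists_balanced_family[where R = R and good = "\<lambda>\<sigma> e. \<sigma> ` e \<in> D", OF this \<epsilon> q0 freq] obtain \<sigma> where \<sigma>: "\<And>s. s < R \<Longrightarrow> \<sigma> s \<in> ?P"
    "(\<Sum>e\<in>?N. (1 + \<epsilon>) ^ card {s. s < R \<and> \<sigma> s ` e \<in> D}) \<le> real (card ?N) * (1 + \<epsilon> * q) ^ R"
    by blast
  have "real (card {s. s < R \<and> \<sigma> s ` e \<in> D}) \<le> (1 + \<epsilon>)\<^sup>2 * q * real R" if e: "e \<in> ?N" for e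
  proof -
    define l where "l = card {s. s < R \<and> \<sigma> s ` e \<in> D}"
    have "(1 + \<epsilon>) ^ l \<le> (\<Sum>e\<in>?N. (1 + \<epsilon>) ^ card {s. s < R \<and> \<sigma> s ` e \<in> D})"
      unfolding l_def using e \<epsilon> \<open>finite ?N\<close> by (intro member_le_sum) auto
    also have "\<dots> \<le> real (card ?N) * (1 + \<epsilon> * q) ^ R" by (rule \<sigma>(2))
    also have "\<dots> \<le> real n ^ 2 * exp (\<epsilon> * q * R)"
    proof (rule mult_mono)
      show "real (card ?N) \<le> real n ^ 2"
        unfolding card_nsets_2 using n by (simp add: power2_eq_square field_simps)
      have "(1 + \<epsilon> * q) ^ R \<le> exp (\<epsilon> * q) ^ R"
        using \<epsilon> q0 by (intro power_mono exp_ge_add_one_self) auto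
      then show "(1 + \<epsilon> * q) ^ R \<le> exp (\<epsilon> * q * R)" by (simp add: exp_of_nat_mult mult.commute)
    qed (use \<epsilon> q0 in auto)
    finally have "(1 + \<epsilon>) ^ l \<le> real n ^ 2 * exp (\<epsilon> * q * R)" .
    then have "ln ((1 + \<epsilon>) ^ l) \<le> ln (real n ^ 2 * exp (\<epsilon> * q * R))" using \<epsilon> n by (intro ln_mono) auto
    then have "l * ln (1 + \<epsilon>) \<le> 2 * ln n + \<epsilon> * q * R" using \<epsilon> n by (simp add: ln_mult ln_realpow)
    also have "\<dots> \<le> \<epsilon> * ((1 + \<epsilon>) * q * R)" using R by (simp add: algebra_simps power2_eq_square)
    finally have "l * ln (1 + \<epsilon>) \<le> \<epsilon> * ((1 + \<epsilon>) * q * R)" .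
    moreover have "\<epsilon> / (1 + \<epsilon>) \<le> ln (1 + \<epsilon>)"
      using ln_le_minus_one[of "1 / (1 + \<epsilon>)"] \<epsilon> by (simp add: ln_div field_simps)
    then have "l * (\<epsilon> / (1 + \<epsilon>)) \<le> l * ln (1 + \<epsilon>)" by (intro mult_left_mono) auto
    ultimately have "l * (\<epsilon> / (1 + \<epsilon>)) \<le> \<epsilon> * ((1 + \<epsilon>) * q * R)" by linarith
    then have "\<epsilon> * real l \<le> \<epsilon> * ((1 + \<epsilon>) * ((1 + \<epsilon>) * q * R))" using \<epsilon> by (simp add: field_simps)
    then show ?thesis using \<epsilon> by (simp add: l_def power2_eq_square mult_ac)
  qed
  then show thesis using that \<sigma>(1) by blast
qed

text \<open>Every potential edge is coloured, present or not, which keeps the coordinates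
  independent; forgetting the colours recovers the random graph for any choice of colour
  distributions \<open>K e\<close>.\<close>

lemma random_graph_conv_colouring:
  "random_graph n p = map_pmf (\<lambda>\<omega>. ({..<n}, {e \<in> nsets {..<n} 2. fst (\<omega> e)}))
     (Pi_pmf (nsets {..<n} 2) (False, d) (\<lambda>e. pair_pmf (bernoulli_pmf p) (K e)))"
proof -
  have "Pi_pmf (nsets {..<n} 2) False (\<lambda>e. map_pmf fst (pair_pmf (bernoulli_pmf p) (K e)))
      = map_pmf (\<lambda>h. fst \<circ> h) (Pi_pmf (nsets {..<n} 2) (False, d) (\<lambda>e. pair_pmf (bernoulli_pmf p) (K e)))"
    by (rule Pi_pmf_map) (auto intro: finite_imp_finite_nsets)
  then show ?thesis
    by (simp add: random_graph_def map_fst_pair_pmf map_pmf_comp)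
qed

text \<open>A pair is coloured uniformly by one of the at most \<open>L\<close> partitions in which
  it lies across a tree edge, so it is present with a given such colour with probability at least
  \<open>p / L\<close>. The failure bound adds the expansion failures over partitions and tree edges
  to the event of too many edges, which is excluded to compare the packing with the actual number of
  edges.\<close>

lemma random_graph_packing_of_partitions:
  fixes T :: "'a ugraph" and p \<epsilon> L z :: real and m :: nat
  defines "t \<equiv> card (verts T)"
  defines "N \<equiv> nsets {..<t * m} 2"
  assumes v: "bij_betw v {..<t} (verts T)"
    and par: "\<And>i. 1 \<le> i \<Longrightarrow> i < t \<Longrightarrow> par i < i"
    and T: "edges T = (\<lambda>i. {v i, v (par i)}) ` {1..<t}"
    and t: "2 \<le> t" and m: "1 \<le> m" and p: "0 < p" "p \<le> 1" and \<epsilon>: "0 < \<epsilon>" "\<epsilon> \<le> 1"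
    and \<sigma>: "\<And>s. s < R \<Longrightarrow> \<sigma> s permutes {..<t * m}"
    and L: "0 < L" "\<And>e. e \<in> N \<Longrightarrow> real (card {s. s < R \<and> \<sigma> s ` e \<in> tree_pairs t m par}) \<le> L"
    and r: "real r \<le> (1 - \<epsilon>) * (p / L) * m"
    and z: "z = exp (- (\<epsilon>\<^sup>2 * (p / L) / 8 * m))" "real m * z \<le> 1"
  shows "1 - (real R * real t * (12 * (real m * z)) + exp (- (\<epsilon>\<^sup>2 * (p * real (card N)))))
    \<le> measure_pmf.prob (random_graph (t * m) p)
      {G. (\<exists>C. edge_disjoint_factors T G C \<and> card (uncovered_edges G C) + R * r * ((t - 1) * m) = card (edges G)) \<and>
        real (card (edges G)) < (1 + 2 * \<epsilon>) * (p * real (card N))}"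
    (is "_ \<le> measure_pmf.prob _ ?Good")
proof -
  let ?D = "tree_pairs t m par"
  \<comment> \<open>\<open>pmf_of_set\<close> requires a nonempty set, so a pair across no tree edge
    of any partition gets the dummy colour 0. It cannot disturb the cut conditions, which look only
    at pairs across tree edges.\<close>
  define K where "K e = (if {s. s < R \<and> \<sigma> s ` e \<in> ?D} = {} then {0} else {s. s < R \<and> \<sigma> s ` e \<in> ?D})" for e
  define P where "P e = pair_pmf (bernoulli_pmf p) (pmf_of_set (K e))" for e
  define J where "J = Pi_pmf N (False, 0) P"
  define W where "W s i = \<sigma> s -` block m i" for s i
  define \<Gamma> where "\<Gamma> = (\<lambda>\<omega> :: nat set \<Rightarrow> bool \<times> nat. ({..<t * m}, {e \<in> N. fst (\<omega> e)}))"
  have m0: "0 < m" using m by simp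
  have finN: "finite N" by (simp add: N_def finite_imp_finite_nsets)
  have K: "finite (K e)" "K e \<noteq> {}" for e by (auto simp: K_def)
  have W: "(\<Union>i<t. W s i) = {..<t * m}" "\<And>i. finite (W s i) \<and> card (W s i) = m"
    "\<And>i j. i \<noteq> j \<Longrightarrow> W s i \<inter> W s j = {}" if s: "s < R" for s
  proof -
    have "(\<Union>i<t. W s i) = \<sigma> s -` (\<Union>i<t. block m i)" by (auto simp: W_def)
    also have "\<dots> = \<sigma> s -` {..<t * m}" unfolding UN_block[OF m0] ..
    also have "\<dots> = {..<t * m}" using permutes_vimage[OF \<sigma>[OF s]] .
    finally show "(\<Union>i<t. W s i) = {..<t * m}" .
    show "finite (W s i) \<and> card (W s i) = m" for i
      using permutes_inj[OF \<sigma>[OF s]] permutes_surj[OF \<sigma>[OF s]]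
      by (auto simp: W_def card_vimage_inj intro: finite_vimageI)
    show "W s i \<inter> W s j = {}" if "i \<noteq> j" for i j
      using block_disjoint[OF m0 that] by (auto simp: W_def)
  qed
  have edge: "{x, y} \<in> N \<and> \<sigma> s ` {x, y} \<in> ?D"
    if s: "s < R" and i: "1 \<le> i" "i < t" and xy: "x \<in> W s (par i)" "y \<in> W s i" for s i x y
  proof -
    have "\<sigma> s x \<in> block m (par i)" "\<sigma> s y \<in> block m i" using xy by (auto simp: W_def)
    moreover have "par i < i" "i \<noteq> par i" using par[OF i] by auto
    moreover have "x \<in> (\<Union>i<t. W s i)" "y \<in> (\<Union>i<t. W s i)" using xy i \<open>par i < i\<close> by auto
    moreover have "x \<noteq> y" using W(3)[OF s \<open>i \<noteq> par i\<close>] xy by auto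
    ultimately show ?thesis using i W(1)[OF s] by (auto simp: N_def tree_pairs_def)
  qed
  have prob_ge: "p / L \<le> measure_pmf.prob (P e) {x. fst x \<and> snd x = s}"
    if "e \<in> N" "s < R" "\<sigma> s ` e \<in> ?D" for e s
  proof -
    have sK: "s \<in> K e" and Ke: "K e = {s. s < R \<and> \<sigma> s ` e \<in> ?D}" using that by (auto simp: K_def)
    then have "0 < card (K e)" using K card_gt_0_iff by blast
    moreover have "real (card (K e)) \<le> L" unfolding Ke using L(2) that by blast
    ultimately have "p / L \<le> p / card (K e)" using p by (intro divide_left_mono) auto
    moreover have "{x. fst x \<and> snd x = s} = {(True, s)}" by auto
    ultimately show ?thesis
      using p sK K[of e] by (simp add: P_def measure_pmf_single pmf_pair)
  qed
  have prob_edge: "measure_pmf.prob (P e) {x. fst x} \<le> p" for e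
  proof -
    have "measure_pmf.prob (P e) {x. fst x} = measure_pmf.prob (map_pmf fst (P e)) {True}"
      by (simp add: vimage_def)
    then show ?thesis using p by (simp add: P_def map_fst_pair_pmf measure_pmf_single)
  qed
  define bad where "bad s i = {\<omega> :: nat set \<Rightarrow> bool \<times> nat. \<exists>A B. A \<subseteq> W s (par i) \<and> B \<subseteq> W s i \<and> m < card A + card B \<and>
      real (card ({(x, y) \<in> W s (par i) \<times> W s i. fst (\<omega> {x, y}) \<and> snd (\<omega> {x, y}) = s} \<inter> A \<times> B))
        < (1 - \<epsilon>) * (p / L * (real (card A) * real (card B)))}" for s i
  define dense where "dense = {\<omega> :: nat set \<Rightarrow> bool \<times> nat. (1 + 2 * \<epsilon>) * (p * real (card N)) \<le> real (card {e \<in> N. fst (\<omega> e)})}"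
  have prob_bad: "measure_pmf.prob J (bad s i) \<le> 12 * (real m * z)"
    if s: "s < R" and i: "1 \<le> i" "i < t" for s i
    unfolding J_def bad_def
  proof (rule prob_not_expanding_le[where Q = "\<lambda>e v. fst v \<and> snd v = s"])
    show "W s (par i) \<inter> W s i = {}" using W(3)[OF s, of "par i" i] par[OF i] by simp
    show "{x, y} \<in> N" if "x \<in> W s (par i)" "y \<in> W s i" for x y using edge[OF s i that] by blast
    show "p / L \<le> measure_pmf.prob (P {x, y}) {v. fst v \<and> snd v = s}"
      if "x \<in> W s (par i)" "y \<in> W s i" for x y using prob_ge edge[OF s i that] s by blast
  qed (use finN W(2)[OF s] p L \<epsilon> z in auto)
  have prob_dense: "measure_pmf.prob J dense \<le> exp (- (\<epsilon>\<^sup>2 * (p * real (card N))))"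
    unfolding J_def dense_def using prob_edge
    by (intro chernoff_upper_Pi_pmf[where Q = "\<lambda>e v. fst v"] finN \<epsilon>) auto
  have good: "\<Gamma> \<omega> \<in> ?Good" if not_bad: "\<And>s i. s < R \<Longrightarrow> 1 \<le> i \<Longrightarrow> i < t \<Longrightarrow> \<omega> \<notin> bad s i" and "\<omega> \<notin> dense" for \<omega>
  proof -
    define E where "E s = {e \<in> N. fst (\<omega> e) \<and> snd (\<omega> e) = s}" for s
    have cut: "cut_condition r (W s (par i)) (W s i) {(x, y) \<in> W s (par i) \<times> W s i. {x, y} \<in> E s}"
      if s: "s < R" and i: "1 \<le> i" "i < t" for s i
    proof (rule cut_condition_if_expanding[OF _ _ _ _ r])
      have E_eq: "{(x, y) \<in> W s (par i) \<times> W s i. {x, y} \<in> E s}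
          = {(x, y) \<in> W s (par i) \<times> W s i. fst (\<omega> {x, y}) \<and> snd (\<omega> {x, y}) = s}"
        using edge[OF s i] by (auto simp: E_def)
      show "(1 - \<epsilon>) * (p / L * (real (card A) * real (card B)))
          \<le> real (card ({(x, y) \<in> W s (par i) \<times> W s i. {x, y} \<in> E s} \<inter> A \<times> B))"
        if "A \<subseteq> W s (par i)" "B \<subseteq> W s i" "m < card A + card B" for A B
      proof -
        have "\<not> real (card ({(x, y) \<in> W s (par i) \<times> W s i. fst (\<omega> {x, y}) \<and> snd (\<omega> {x, y}) = s} \<inter> A \<times> B))
            < (1 - \<epsilon>) * (p / L * (real (card A) * real (card B)))"
          using not_bad[OF s i] that unfolding bad_def by blast
        then show ?thesis unfolding E_eq by linarith
      qed
    qed (use W(2)[OF s] p L \<epsilon> in auto)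
    have "\<exists>C. edge_disjoint_factors T (\<Gamma> \<omega>) C \<and>
        card (uncovered_edges (\<Gamma> \<omega>) C) + R * r * ((t - 1) * m) = card (edges (\<Gamma> \<omega>))"
      by (rule packing_of_partitions[where T = T and E = E and W = W, folded t_def, OF v par T t m])
        (use cut W finN in \<open>auto simp: \<Gamma>_def E_def\<close>)
    moreover have "real (card (edges (\<Gamma> \<omega>))) < (1 + 2 * \<epsilon>) * (p * real (card N))"
      using \<open>\<omega> \<notin> dense\<close> by (simp add: dense_def \<Gamma>_def)
    ultimately show ?thesis by blast
  qed
  have "random_graph (t * m) p = map_pmf \<Gamma> J"
    unfolding random_graph_conv_colouring[of _ _ 0 "\<lambda>e. pmf_of_set (K e)"] \<Gamma>_def J_def P_def N_def ..
  then have "measure_pmf.prob (random_graph (t * m) p) ?Good = measure_pmf.prob J (\<Gamma> -` ?Good)" by simp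
  moreover have "1 - measure_pmf.prob J (\<Gamma> -` ?Good) = measure_pmf.prob J (- (\<Gamma> -` ?Good))"
    using measure_pmf.prob_compl[of "\<Gamma> -` ?Good" J] by (simp add: Compl_eq_Diff_UNIV)
  moreover have "measure_pmf.prob J (- (\<Gamma> -` ?Good))
      \<le> measure_pmf.prob J ((\<Union>(s, i)\<in>{..<R} \<times> {1..<t}. bad s i) \<union> dense)"
    using good by (intro measure_pmf.finite_measure_mono) auto
  moreover have "\<dots> \<le> measure_pmf.prob J (\<Union>(s, i)\<in>{..<R} \<times> {1..<t}. bad s i) + measure_pmf.prob J dense"
    by (intro measure_Un_le) auto
  moreover have "measure_pmf.prob J (\<Union>(s, i)\<in>{..<R} \<times> {1..<t}. bad s i)
      \<le> (\<Sum>(s, i)\<in>{..<R} \<times> {1..<t}. measure_pmf.prob J (bad s i))"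
    using measure_pmf.finite_measure_subadditive_finite[of "{..<R} \<times> {1..<t}" "\<lambda>(s, i). bad s i" J]
    by (simp add: case_prod_unfold)
  moreover have "\<dots> \<le> (\<Sum>(s, i)\<in>{..<R} \<times> {1..<t}. 12 * (real m * z))"
    using prob_bad by (intro sum_mono) auto
  moreover have "\<dots> \<le> real R * real t * (12 * (real m * z))"
  proof -
    have "0 \<le> z" by (simp add: z(1))
    then have "real R * real (t - 1) * (12 * (real m * z)) \<le> real R * real t * (12 * (real m * z))"
      by (intro mult_right_mono mult_left_mono) auto
    then show ?thesis by (simp add: card_cartesian_product case_prod_unfold)
  qed
  ultimately show ?thesis using prob_dense by linarith
qed

section \<open>Choice of parameters\<close>

text \<open>Subtracting gives \<open>u \<le> 6 * \<epsilon> * \<mu>\<close>. The packing itself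
  bounds the edges from below, \<open>e \<ge> c \<ge> \<mu> / 2\<close> as
  \<open>\<epsilon> \<le> 1/8\<close>, and this doubles the 6 to the final constant 12.\<close>

lemma uncovered_bound_arith:
  fixes u c e \<mu> \<epsilon> :: real
  assumes "u + c = e" "(1 - 4 * \<epsilon>) * \<mu> \<le> c" "e \<le> (1 + 2 * \<epsilon>) * \<mu>" "0 \<le> u" "0 \<le> \<mu>" "0 < \<epsilon>" "\<epsilon> \<le> 1/8"
  shows "u \<le> 12 * \<epsilon> * e"
proof -
  have "u \<le> 6 * \<epsilon> * \<mu>" using assms by (simp add: algebra_simps)
  have "\<epsilon> * \<mu> \<le> 1/8 * \<mu>" using assms by (intro mult_right_mono) auto
  then have "\<mu> \<le> 2 * e" using assms by (simp add: algebra_simps)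
  then have "6 * \<epsilon> * \<mu> \<le> 6 * \<epsilon> * (2 * e)" using assms by (intro mult_left_mono) auto
  then show ?thesis using \<open>u \<le> 6 * \<epsilon> * \<mu>\<close> by simp
qed

text \<open>The constant in \<open>large\<close> is \<open>192 = 32 * 6\<close>: the 6 is from
  \<open>L \<le> 6 * t * l / \<epsilon>^2\<close>, the 32 is what makes
  \<open>z \<le> 1 / n ^ 4\<close>. One factor \<open>t\<close> belongs to the bound on
  \<open>L\<close>, the other to \<open>n = t * m\<close>.\<close>

lemma random_graph_packing:
  fixes T :: "'a ugraph" and p \<epsilon> :: real and m :: nat
  defines "t \<equiv> card (verts T)"
  defines "n \<equiv> t * m"
  assumes tree: "is_tree T" and t: "2 \<le> t" and m: "1 \<le> m" and lnn: "1 \<le> ln (real n)"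
    and p: "0 < p" "p \<le> 1" and \<epsilon>: "0 < \<epsilon>" "\<epsilon> \<le> 1/8"
    and large: "192 * (real t)\<^sup>2 * (ln (real n))\<^sup>2 \<le> \<epsilon> ^ 4 * real n * p"
  shows "1 - 37 * real t / real n \<le> measure_pmf.prob (random_graph n p)
      {G. \<exists>C. edge_disjoint_factors T G C \<and>
        real (card (uncovered_edges G C)) \<le> 12 * \<epsilon> * real (card (edges G))}"
proof -
  obtain v par where v: "bij_betw v {..<t} (verts T)" and par: "\<forall>i\<in>{1..<t}. par i < i"
    and T: "edges T = (\<lambda>i. {v i, v (par i)}) ` {1..<t}"
    using tree_parent_enumeration[OF tree, folded t_def] by (elim exE conjE) (rule that)
  have par': "par i < i" if "1 \<le> i" "i < t" for i using par that by simp
  define N where "N = nsets {..<n} 2"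
  define D where "D = tree_pairs t m par"
  define q where "q = real (card D) / real (card N)"
  define l where "l = ln (real n)"
  have m0: "0 < m" using m by simp
  have n_eq: "real n = real t * real m" by (simp add: n_def)
  have n2: "2 \<le> n" using mult_le_mono[OF t m] by (simp add: n_def)
  have DN: "D \<subseteq> N" and cD: "card D = (t - 1) * (m * m)"
    using tree_pairs_subset[OF m0 par'] card_tree_pairs[OF m0 par'] by (auto simp: D_def N_def n_def)
  have finN: "finite N" by (simp add: N_def finite_imp_finite_nsets)
  have cN: "real (card N) = real n * (real n - 1) / 2" by (simp only: N_def card_nsets_2)
  have cN0: "0 < real (card N)" using n2 by (simp add: cN)
  have q1: "q \<le> 1" using card_mono[OF finN DN] cN0 by (simp add: q_def divide_le_eq)
  \<comment> \<open>There are at most \<open>t^2 * m^2 / 2\<close> pairs in all, and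
    \<open>(t - 1) * m^2 \<ge> t * m^2 / 2\<close> of them lie across tree edges.\<close>
  have qt: "1 / real t \<le> q"
  proof -
    have "real (card N) \<le> real n * real n / 2" unfolding cN by (simp add: algebra_simps)
    also have "\<dots> = real t * (real t / 2 * (real m * real m))" by (simp add: n_eq)
    also have "\<dots> \<le> real t * (real (t - 1) * (real m * real m))"
      using t by (intro mult_left_mono mult_right_mono) (auto simp: of_nat_diff)
    also have "\<dots> = real t * real (card D)" by (simp add: cD)
    finally show ?thesis using t cN0 by (simp add: q_def field_simps)
  qed
  have q0: "0 < q" using qt t by (smt (verit) divide_pos_pos of_nat_0_less_iff zero_less_one pos2 order_less_le_trans)
  have l1: "1 \<le> l" using lnn by (simp add: l_def)
  have t0: "2 \<le> real t" using t by simp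
  have large': "192 * (real t)\<^sup>2 * l\<^sup>2 \<le> \<epsilon> ^ 4 * real n * p" using large by (simp add: l_def)
  have e2: "\<epsilon>\<^sup>2 \<le> 1" using \<epsilon> by (simp add: power_le_one)
  have e21: "0 < \<epsilon>\<^sup>2" using \<epsilon> by simp
  \<comment> \<open>The least number of partitions that the balancing lemma accepts; a larger one
    would only dilute the density \<open>p / L\<close>.\<close>
  define R where "R = nat \<lceil>2 * l / (\<epsilon>\<^sup>2 * q)\<rceil>"
  have R_ge: "2 * l / (\<epsilon>\<^sup>2 * q) \<le> real R" unfolding R_def by linarith
  then have R1: "2 * l \<le> \<epsilon>\<^sup>2 * q * real R" using e21 q0 by (simp add: field_simps)
  have R_pos: "0 < real R" using R1 l1 e21 q0 by (smt (verit) mult_nonneg_nonpos mult_pos_pos)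
  have R_le: "real R \<le> 3 * real t * l / \<epsilon>\<^sup>2"
  proof -
    have "real R \<le> 2 * l / (\<epsilon>\<^sup>2 * q) + 1"
    proof -
      have "0 \<le> 2 * l / (\<epsilon>\<^sup>2 * q)" using l1 e21 q0 by simp
      then show ?thesis unfolding R_def by linarith
    qed
    also have "2 * l / (\<epsilon>\<^sup>2 * q) = 2 * l / \<epsilon>\<^sup>2 * (1 / q)" by simp
    also have "\<dots> \<le> 2 * l / \<epsilon>\<^sup>2 * real t"
      using qt q0 t0 l1 by (intro mult_left_mono) (auto simp: field_simps)
    also have "1 \<le> real t * l / \<epsilon>\<^sup>2"
    proof -
      have "1 * 1 \<le> real t * l" using t0 l1 by (intro mult_mono) auto
      then show ?thesis using e2 e21 by (simp add: pos_le_divide_eq)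
    qed
    finally show ?thesis by (simp add: field_simps)
  qed
  define L where "L = (1 + \<epsilon>)\<^sup>2 * q * real R"
  have L_pos: "0 < L" using \<epsilon> q0 R_pos by (simp add: L_def)
  have L_le: "L \<le> 6 * real t * l / \<epsilon>\<^sup>2"
  proof -
    have "(1 + \<epsilon>)\<^sup>2 \<le> (9/8)\<^sup>2" using \<epsilon> by (intro power_mono) auto
    then have "(1 + \<epsilon>)\<^sup>2 \<le> 2" by (simp add: power2_eq_square)
    then have "(1 + \<epsilon>)\<^sup>2 * q \<le> 2 * 1" using q1 q0 by (intro mult_mono) auto
    then have "L \<le> 2 * real R" unfolding L_def using R_pos by (simp add: mult_right_mono)
    then show ?thesis using R_le by simp
  qed
  obtain \<sigma> where \<sigma>: "\<And>s. s < R \<Longrightarrow> \<sigma> s permutes {..<n}"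
    "\<And>e. e \<in> N \<Longrightarrow> real (card {s. s < R \<and> \<sigma> s ` e \<in> D}) \<le> L"
  proof (rule exists_balanced_permutations[OF n2 DN[unfolded N_def] \<epsilon>(1) q_def[unfolded N_def] R1[unfolded l_def]])
    fix \<sigma> assume "\<And>s. s < R \<Longrightarrow> \<sigma> s permutes {..<n}"
      "\<And>e. e \<in> nsets {..<n} 2 \<Longrightarrow> real (card {s. s < R \<and> \<sigma> s ` e \<in> D}) \<le> (1 + \<epsilon>)\<^sup>2 * q * real R"
    then show thesis unfolding N_def[symmetric] L_def[symmetric] by (rule that)
  qed
  have key: "32 * l \<le> \<epsilon>\<^sup>2 * (p / L) * real m"
  proof -
    have "192 * (real t)\<^sup>2 * l\<^sup>2 \<le> \<epsilon> ^ 4 * (real t * real m) * p" using large' by (simp add: n_eq)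
    then have "real t * (192 * real t * l\<^sup>2) \<le> real t * (\<epsilon> ^ 4 * real m * p)"
      by (simp add: power2_eq_square mult_ac)
    then have "192 * real t * l\<^sup>2 \<le> \<epsilon> ^ 4 * real m * p" using t0 by simp
    then have "32 * l * (6 * real t * l / \<epsilon>\<^sup>2) \<le> \<epsilon>\<^sup>2 * p * real m"
      using e21 by (simp add: field_simps power2_eq_square eval_nat_numeral)
    then have "32 * l * L \<le> \<epsilon>\<^sup>2 * p * real m"
      using mult_left_mono[OF L_le, of "32 * l"] l1 by simp
    then show ?thesis using L_pos by (simp add: field_simps)
  qed
  define z where "z = exp (- (\<epsilon>\<^sup>2 * (p / L) / 8 * m))"
  have n0: "0 < real n" using n2 by simp
  have z_le: "z \<le> 1 / real n ^ 4"
  proof -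
    have "z \<le> exp (- (4 * l))" unfolding z_def using key by simp
    also have "\<dots> = 1 / exp l ^ 4" by (simp add: exp_minus inverse_eq_divide exp_of_nat_mult[symmetric])
    also have "exp l = real n" using n0 by (simp add: l_def)
    finally show ?thesis .
  qed
  have z0: "0 \<le> z" by (simp add: z_def)
  have tn: "real t * real m * z \<le> 1 / real n ^ 3"
  proof -
    have "real n * z \<le> real n * (1 / real n ^ 4)" using z_le by (intro mult_left_mono) auto
    also have "\<dots> = 1 / real n ^ 3" using n0 by (simp add: eval_nat_numeral)
    finally show ?thesis by (simp add: n_eq)
  qed
  have mz: "real m * z \<le> 1"
  proof -
    have "1 * (real m * z) \<le> real t * (real m * z)" using t0 z0 by (intro mult_right_mono) auto
    also have "\<dots> \<le> 1 / real n ^ 3" using tn by (simp add: mult_ac)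
    also have "\<dots> \<le> 1" using n2 by simp
    finally show ?thesis by simp
  qed
  define r where "r = nat \<lfloor>(1 - \<epsilon>) * (p / L) * m\<rfloor>"
  have pLm: "0 \<le> (1 - \<epsilon>) * (p / L) * m" using \<epsilon> p L_pos by simp
  have r_le: "real r \<le> (1 - \<epsilon>) * (p / L) * m" using pLm unfolding r_def by simp
  \<comment> \<open>Rounding \<open>r\<close> down loses at most 1, which \<open>key\<close> bounds
    by \<open>\<epsilon> * (p / L) * m\<close>; so it costs one further
    \<open>\<epsilon>\<close>.\<close>
  have r_ge: "(1 - 2 * \<epsilon>) * (p / L) * m \<le> real r"
  proof -
    have "\<epsilon>\<^sup>2 * (p / L) * real m \<le> \<epsilon> * (p / L) * real m"
      using \<epsilon> p L_pos by (intro mult_right_mono) (auto simp: power2_eq_square)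
    then have "1 \<le> \<epsilon> * (p / L) * real m" using key l1 by linarith
    moreover have "(1 - \<epsilon>) * (p / L) * m - 1 < real r" unfolding r_def using pLm by linarith
    moreover have "(1 - 2 * \<epsilon>) * (p / L) * m = (1 - \<epsilon>) * (p / L) * m - \<epsilon> * (p / L) * m"
      by (simp only: left_diff_distrib[symmetric]) simp
    ultimately show ?thesis by linarith
  qed
  define \<mu> where "\<mu> = p * real (card N)"
  have mu0: "0 \<le> \<mu>" using p by (simp add: \<mu>_def)
  \<comment> \<open>Inserting \<open>L = (1 + \<epsilon>)^2 * q * R\<close> and
    \<open>q = card D / card N\<close> cancels \<open>R\<close> and the number of tree pairs,
    leaving the factor \<open>(1 - 2 * \<epsilon>) / (1 + \<epsilon>)^2\<close> on the expected edge
    number \<open>\<mu>\<close>.\<close>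
  have covered: "(1 - 4 * \<epsilon>) * \<mu> \<le> real (R * r * ((t - 1) * m))"
  proof -
    have "(1 - 4 * \<epsilon>) * (1 + \<epsilon>)\<^sup>2 \<le> 1 - 2 * \<epsilon>"
      using \<epsilon> by (simp add: power2_eq_square algebra_simps)
    then have "(1 - 4 * \<epsilon>) * \<mu> \<le> (1 - 2 * \<epsilon>) / (1 + \<epsilon>)\<^sup>2 * \<mu>"
      using \<epsilon> mu0 by (intro mult_right_mono) (auto simp: pos_le_divide_eq)
    also have "\<dots> = (1 - 2 * \<epsilon>) * (p / L) * m * (real R * (real (t - 1) * m))"
    proof -
      have "real (card N) * q = real (card D)" using cN0 by (simp add: q_def)
      then have "real (card N) = real (card D) / q" using q0 by (simp only: eq_divide_eq) simp
      then have "\<mu> = p * (real (card D) / q)" by (simp only: \<mu>_def)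
      then show ?thesis using q0 R_pos \<epsilon> by (simp add: L_def cD)
    qed
    also have "\<dots> \<le> real r * (real R * (real (t - 1) * m))"
      using r_ge by (intro mult_right_mono) auto
    finally show ?thesis by (simp add: mult_ac)
  qed
  \<comment> \<open>Crudely, \<open>large\<close> gives \<open>l / \<epsilon>^2 \<le> n\<close>,
    hence \<open>R \<le> 3 * t * n\<close>; with \<open>t * m * z \<le> 1 / n ^ 3\<close> the
    expansion failures stay below \<open>36 * t / n\<close>. One more \<open>t / n\<close> pays for
    the edge count, whose failure bound is at most \<open>exp (- l) = 1 / n\<close>.\<close>
  have "1 - 37 * real t / real n \<le> 1 - (real R * real t * (12 * (real m * z)) + exp (- (\<epsilon>\<^sup>2 * (p * real (card N)))))"
  proof -
    have large1: "192 * (real t)\<^sup>2 * l\<^sup>2 \<le> \<epsilon>\<^sup>2 * (\<epsilon>\<^sup>2 * real n * p)" using large' by (simp add: eval_nat_numeral mult_ac)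
    have tl: "1 \<le> 192 * (real t)\<^sup>2 * l" "1 \<le> 192 * (real t)\<^sup>2"
    proof -
      have "1 \<le> (real t)\<^sup>2" using t0 by (simp add: one_le_power)
      then show "1 \<le> 192 * (real t)\<^sup>2" by simp
      then show "1 \<le> 192 * (real t)\<^sup>2 * l" using l1 mult_mono[of 1 "192 * (real t)\<^sup>2" 1 l] by simp
    qed
    have ln_le: "l \<le> \<epsilon>\<^sup>2 * (\<epsilon>\<^sup>2 * real n * p)"
    proof -
      have "1 * l \<le> (192 * (real t)\<^sup>2 * l) * l" using tl l1 by (intro mult_right_mono) auto
      then show ?thesis using large1 by (simp add: power2_eq_square mult_ac)
    qed
    have "\<epsilon>\<^sup>2 * real n * p \<le> 1 * real n * 1" using e2 p by (intro mult_mono) auto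
    then have "\<epsilon>\<^sup>2 * (\<epsilon>\<^sup>2 * real n * p) \<le> \<epsilon>\<^sup>2 * real n" using e21 by simp
    then have "l / \<epsilon>\<^sup>2 \<le> real n" using ln_le e21 by (simp add: field_simps)
    then have "3 * real t * (l / \<epsilon>\<^sup>2) \<le> 3 * real t * real n" using t0 by (intro mult_left_mono) auto
    then have "real R \<le> 3 * real t * real n" using R_le by simp
    then have "real R * (12 * (real t * real m * z)) \<le> (3 * real t * real n) * (12 * (1 / real n ^ 3))"
      using tn z0 by (intro mult_mono) auto
    also have "\<dots> = 36 * real t / real n * (1 / real n)" using n0 by (simp add: eval_nat_numeral)
    also have "\<dots> \<le> 36 * real t / real n * 1" using n2 t0 by (intro mult_left_mono) auto
    finally have b1: "real R * real t * (12 * (real m * z)) \<le> 36 * real t / real n" by (simp add: mult_ac)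
    have "l \<le> \<epsilon>\<^sup>2 * (p * real (card N))"
    proof -
      have "\<epsilon>\<^sup>2 * (\<epsilon>\<^sup>2 * real n * p) \<le> 1/64 * (\<epsilon>\<^sup>2 * real n * p)"
        using \<epsilon> p power_mono[of \<epsilon> "1/8" 2] by (intro mult_right_mono) (auto simp: power2_eq_square)
      also have "\<dots> = \<epsilon>\<^sup>2 * p * (real n * (1/64))" by simp
      also have "\<dots> \<le> \<epsilon>\<^sup>2 * p * (real n * ((real n - 1) / 2))"
        using n2 p by (intro mult_left_mono) auto
      finally show ?thesis using ln_le by (simp add: cN)
    qed
    then have "exp (- (\<epsilon>\<^sup>2 * (p * real (card N)))) \<le> exp (- l)" by simp
    also have "\<dots> = 1 / real n" using n0 by (simp add: l_def exp_minus inverse_eq_divide)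
    also have "\<dots> \<le> real t / real n" using t0 n0 by (simp add: divide_right_mono)
    finally have "exp (- (\<epsilon>\<^sup>2 * (p * real (card N)))) \<le> real t / real n" .
    moreover have "37 * real t / real n = 36 * real t / real n + real t / real n"
      by (simp add: add_divide_distrib[symmetric])
    ultimately show ?thesis using b1 by linarith
  qed
  also have "\<dots> \<le> measure_pmf.prob (random_graph n p)
      {G. (\<exists>C. edge_disjoint_factors T G C \<and> card (uncovered_edges G C) + R * r * ((t - 1) * m) = card (edges G)) \<and>
        real (card (edges G)) < (1 + 2 * \<epsilon>) * (p * real (card N))}"
    unfolding N_def n_def
    by (rule random_graph_packing_of_partitions[where T = T and v = v and par = par and \<sigma> = \<sigma> and L = L, folded t_def])
      (use v par' T t m p \<epsilon> \<sigma> L_pos r_le z_def mz in \<open>auto simp: n_def N_def D_def\<close>)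
  also have "\<dots> \<le> measure_pmf.prob (random_graph n p)
      {G. \<exists>C. edge_disjoint_factors T G C \<and>
        real (card (uncovered_edges G C)) \<le> 12 * \<epsilon> * real (card (edges G))}"
  proof (rule measure_pmf.finite_measure_mono)
    have uncovered: "real (card (uncovered_edges G C)) \<le> 12 * \<epsilon> * real (card (edges G))"
      if "card (uncovered_edges G C) + R * r * ((t - 1) * m) = card (edges G)"
        "real (card (edges G)) < (1 + 2 * \<epsilon>) * (p * real (card N))" for G :: "nat ugraph" and C
    proof (rule uncovered_bound_arith[OF _ covered])
      show "real (card (uncovered_edges G C)) + real (R * r * ((t - 1) * m)) = real (card (edges G))"
        using that(1) by (simp only: of_nat_add[symmetric])
    qed (use that(2) mu0 \<epsilon> in \<open>auto simp: \<mu>_def\<close>)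
    show "{G :: nat ugraph. (\<exists>C. edge_disjoint_factors T G C \<and> card (uncovered_edges G C) + R * r * ((t - 1) * m) = card (edges G)) \<and>
        real (card (edges G)) < (1 + 2 * \<epsilon>) * (p * real (card N))} \<subseteq> {G. \<exists>C. edge_disjoint_factors T G C \<and>
        real (card (uncovered_edges G C)) \<le> 12 * \<epsilon> * real (card (edges G))}"
      using uncovered by blast
  qed simp
  finally show ?thesis .
qed

section \<open>Passage to the limit\<close>

text \<open>The empty packing already suffices. This settles those \<open>n\<close> for which
  \<open>\<epsilon> n\<close> exceeds \<open>1/8\<close>, as \<open>\<epsilon>\<close> is not
  assumed to be small.\<close>

lemma prob_trivial_packing:
  assumes "1 \<le> M * \<epsilon>"
  shows "measure_pmf.prob (random_graph n p)
      {G. \<exists>C. edge_disjoint_factors T G C \<and>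
        real (card (uncovered_edges G C)) \<le> M * \<epsilon> * real (card (edges G))} = 1"
proof -
  have "edge_disjoint_factors T G {} \<and>
        real (card (uncovered_edges G {})) \<le> M * \<epsilon> * real (card (edges G))" for G :: "nat ugraph"
    using mult_right_mono[OF assms, of "real (card (edges G))"]
    by (simp add: edge_disjoint_factors_def uncovered_edges_def)
  then have "G \<in> {G. \<exists>C. edge_disjoint_factors T G C \<and>
        real (card (uncovered_edges G C)) \<le> M * \<epsilon> * real (card (edges G))}" for G :: "nat ugraph"
    by (intro CollectI exI[of _ "{}"])
  then have "{G :: nat ugraph. \<exists>C. edge_disjoint_factors T G C \<and>
        real (card (uncovered_edges G C)) \<le> M * \<epsilon> * real (card (edges G))} = UNIV"
    by (rule UNIV_eq_I[symmetric])
  then show ?thesis by simp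
qed

theorem theorem2:
  fixes T :: "'a ugraph"
  assumes "is_tree T" and "card (verts T) \<ge> 2"
  shows "\<exists>M::real. \<forall>(\<epsilon> :: nat \<Rightarrow> real) (p :: nat \<Rightarrow> real).
    (\<forall>n. \<epsilon> n > 0) \<longrightarrow> (\<forall>n. 0 < p n \<and> p n \<le> 1) \<longrightarrow>
    filterlim (\<lambda>n. (\<epsilon> n ^ 4 * real n * p n) / (ln (real n))\<^sup>2) at_top
      (multiples_at_top (card (verts T))) \<longrightarrow>
    ((\<lambda>n. measure_pmf.prob (random_graph n (p n))
        {G. \<exists>C. edge_disjoint_factors T G C \<and>
              real (card (uncovered_edges G C)) \<le> M * \<epsilon> n * real (card (edges G))})
      \<longlongrightarrow> 1) (multiples_at_top (card (verts T)))"
proof (intro exI[of _ 12] allI impI)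
  fix \<epsilon> p :: "nat \<Rightarrow> real"
  assume \<epsilon>: "\<forall>n. \<epsilon> n > 0" and p: "\<forall>n. 0 < p n \<and> p n \<le> 1"
    and lim: "filterlim (\<lambda>n. (\<epsilon> n ^ 4 * real n * p n) / (ln (real n))\<^sup>2) at_top (multiples_at_top (card (verts T)))"
  define t where "t = card (verts T)"
  let ?F = "multiples_at_top t"
  let ?prob = "\<lambda>n. measure_pmf.prob (random_graph n (p n))
        {G. \<exists>C. edge_disjoint_factors T G C \<and>
              real (card (uncovered_edges G C)) \<le> 12 * \<epsilon> n * real (card (edges G))}"
  have F_le: "?F \<le> at_top" by (simp add: multiples_at_top_def)
  have "eventually (\<lambda>n. 1 \<le> ln (real n)) at_top" by real_asymp
  then have ev_ln: "eventually (\<lambda>n. 1 \<le> ln (real n)) ?F" using F_le filter_leD by blast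
  have ev_dvd: "eventually (\<lambda>n. t dvd n) ?F"
    by (simp add: multiples_at_top_def eventually_inf_principal)
  \<comment> \<open>The divergence enters through the fixed threshold \<open>192 * t^2\<close> of
    \<open>random_graph_packing\<close>.\<close>
  have ev_large: "eventually (\<lambda>n. 192 * (real t)\<^sup>2 \<le> (\<epsilon> n ^ 4 * real n * p n) / (ln (real n))\<^sup>2) ?F"
    using lim unfolding t_def filterlim_at_top by blast
  have lower: "eventually (\<lambda>n. 1 - 37 * real t / real n \<le> ?prob n) ?F"
    using ev_ln ev_dvd ev_large
  proof eventually_elim
    case (elim n)
    show ?case
    \<comment> \<open>The split is made for each \<open>n\<close> separately, since
      \<open>\<epsilon> n\<close> may lie on either side of \<open>1/8\<close> infinitely
      often.\<close>
    proof (cases "\<epsilon> n \<le> 1/8")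
      case False
      then have "?prob n = 1" by (intro prob_trivial_packing) simp
      then show ?thesis by simp
    next
      case True
      obtain m where m: "n = t * m" using elim by blast
      have "1 \<le> m" using elim(1) m by (cases m) auto
      have "192 * (real t)\<^sup>2 * (ln (real n))\<^sup>2 \<le> \<epsilon> n ^ 4 * real n * p n"
        using elim(1,3) by (simp add: pos_le_divide_eq)
      then show ?thesis
        using random_graph_packing[OF assms(1), of m "p n" "\<epsilon> n"] assms(2) \<open>1 \<le> m\<close> elim(1) True \<epsilon> p
        unfolding m t_def by simp
    qed
  qed
  have "((\<lambda>n. 1 - 37 * real t / real n) \<longlongrightarrow> 1) at_top" by real_asymp
  then have "((\<lambda>n. 1 - 37 * real t / real n) \<longlongrightarrow> 1) ?F" using F_le tendsto_mono by blast
  moreover have "eventually (\<lambda>n. ?prob n \<le> 1) ?F" by simp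
  ultimately show "(?prob \<longlongrightarrow> 1) (multiples_at_top (card (verts T)))"
    unfolding t_def[symmetric] using tendsto_sandwich[OF lower _ _ tendsto_const] by blast
qed

end
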